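(* Let $q$ be a power of a prime $p$ and let $E/\mathbb{F}_q$ be an elliptic curve (of spinorial type) with a spin structure $(B,\sigma)$, $B=\mathrm{End}(E)$. Let $K=C^+(B,\sigma)$ be the associated even Clifford algebra, and let $\tau\in\mathrm{End}(E)$ be the Frobenius endomorphism of $E$. Then a lift $\rho_E^{spin}:W(\bar{\mathbb{F}}_q/\mathbb{F}_q)\to\mathrm{GSpin}(B,\sigma)$ of the canonical similitude representation $\rho_{E,\sigma}:W(\bar{\mathbb{F}}_q/\mathbb{F}_q)\to\mathrm{GO}^+(B,\sigma)$ exists if and only if $K=\mathbb{Q}(\sqrt{\tau})$.
   Context: For an elliptic curve $E$ over a field $k$, $\mathrm{End}(E)=\mathrm{End}_k(E)$ denotes the $\mathbb{Q}$-algebra of endomorphisms of $E$ defined over $k$ (endomorphism ring tensored with $\mathbb{Q}$). An involution of the first kind on a finite dimensional algebra $A$ over a field $F$ is an additive map $\sigma:A\to A$ with $\sigma(xy)=\sigma(y)\sigma(x)$, $\sigma^2=\mathrm{id}$, and $\sigma$ the identity on the center of $A$. $E$ is of spinorial type if $\mathrm{End}_k(E)$ admits a non-trivial involution of the first kind (equivalently, $\mathrm{End}_k(E)$ is a quaternion algebra over $\mathbb{Q}$). An involution of the first kind on a quaternion algebra $B/F$ (characteristic of $F$ not $2$) is orthogonal if, over a splitting field $K'$ with $B\otimes_F K'\cong \mathrm{End}_{K'}(V)$, it becomes the adjoint involution of a non-degenerate symmetric bilinear form on $V$. Equivalently, $\sigma(x)=u\gamma(x)u^{-1}$, where $\gamma$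 is the canonical (symplectic) conjugation on $B$ and $u\in B^*$ satisfies $\gamma(u)=-u$; its discriminant is $\mathrm{disc}(\sigma)=-\mathrm{Nrd}(u)\in F^*/F^{*2}$. Let $E/\mathbb{F}_q$ be of spinorial type, $B=\mathrm{End}(E)$. A spin structure $(B,\sigma)$ on $E$ is a choice of an orthogonal involution (of the first kind) $\sigma$ on $B$. The even Clifford algebra is $K=C^+(B,\sigma)=\mathbb{Q}[X]/(X^2-\delta_\sigma)$ with $\delta_\sigma$ a representative of $\mathrm{disc}(\sigma)$; one has $K\cong\mathbb{Q}(u)\subset B$. The group of proper similitudes $\mathrm{GO}^+(B,\sigma)=\{g\in B^*: \sigma(g)g\in\mathbb{Q}^*,\ \sigma(g)g=\mathrm{Nrd}(g)\}$ is, as an algebraic group, $R_{K/\mathbb{Q}}\mathbb{G}_m$ (via $K\cong \mathbb{Q}(u)$). Define $\mathrm{GSpin}(B,\sigma)=R_{K/\mathbb{Q}}\mathbb{G}_m$ with the map $\mathrm{GSpin}(B,\sigma)\to\mathrm{GO}^+(B,\sigma)$ given by squaring; on $\mathbb{Q}$-points it is $K^*\to K^*$, $x\mapsto x^2$. The $q$-Frobenius endomorphism $\tau$ lies in the center $\mathbb{Q}$ of $B$. The Weil group $W(\bar{\mathbb{F}}_q/\mathbb{F}_q)\cong\mathbb{Z}$ is generated by the geometric Frobenius $\mathrm{Frob}_{geom}$, and the canonical similitude representation $\rho_{E,\sigma}$ is the homomorphism $W(\bar{\mathbb{F}}_q/\mathbb{F}_q)\to \mathrm{GO}^+(B,\sigma)(\mathbb{Q})=K^*$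 sending $\mathrm{Frob}_{geom}$ to $\tau$. A lift is a homomorphism $W(\bar{\mathbb{F}}_q/\mathbb{F}_q)\to\mathrm{GSpin}(B,\sigma)(\mathbb{Q})=K^*$ whose composite with the squaring map to $\mathrm{GO}^+(B,\sigma)(\mathbb{Q})$ is $\rho_{E,\sigma}$.
   Formalization: The formal theorem assumes in addition that √τ is irrational; if τ is a rational square (e.g. τ = p² over the field with p⁴ elements) a lift always exists, while K is a quadratic field and ℚ(√τ) = ℚ, so the stated equivalence fails. *)

theory Defs
  imports
    "HOL-Analysis.Analysis"
    "HOL-Algebra.Bij"
    "HOL-Algebra.QuotRing"
    "HOL-Algebra.Generated_Fields"
    "HOL-Algebra.Algebraic_Closure_Type"
begin

section \<open>Elliptic curves and their endomorphisms\<close>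

text \<open>
  An elliptic curve over \<open>k\<close> is given by a general Weierstrass equation
  \<open>y\<^sup>2 + a1 x y + a3 y = x\<^sup>3 + a2 x\<^sup>2 + a4 x + a6\<close> with nonzero discriminant, so that
  characteristics 2 and 3 are included.
\<close>

record 'k weierstrass =
  a1 :: 'k
  a2 :: 'k
  a3 :: 'k
  a4 :: 'k
  a6 :: 'k

definition weierstrass_disc :: "'k::field weierstrass \<Rightarrow> 'k" where
  "weierstrass_disc E =
     (let b2 = (a1 E)^2 + 4 * a2 E;
          b4 = 2 * a4 E + a1 E * a3 E;
          b6 = (a3 E)^2 + 4 * a6 E;
          b8 = (a1 E)^2 * a6 E + 4 * a2 E * a6 E - a1 E * a3 E * a4 E + a2 E * (a3 E)^2 - (a4 E)^2
      in - (b2^2 * b8) - 8 * b4^3 - 27 * b6^2 + 9 * b2 * b4 * b6)"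

definition elliptic_curve :: "'k::field weierstrass \<Rightarrow> bool" where
  "elliptic_curve E \<longleftrightarrow> weierstrass_disc E \<noteq> 0"

datatype 'a point = Origin | Affine 'a 'a

definition points :: "'k::field weierstrass \<Rightarrow> 'k alg_closure point set" where
  "points E = insert Origin {Affine x y | x y.
     y^2 + to_ac (a1 E) * x * y + to_ac (a3 E) * y
       = x^3 + to_ac (a2 E) * x^2 + to_ac (a4 E) * x + to_ac (a6 E)}"

text \<open>
  The chord-tangent law: the line through the two points is \<open>y = l x + n\<close>, and the second case of
  the slope is the tangent line.
\<close>

fun point_add ::
  "'k::field weierstrass \<Rightarrow> 'k alg_closure point \<Rightarrow> 'k alg_closure point \<Rightarrow> 'k alg_closure point"
where
  "point_add E Origin Q = Q"
| "point_add E (Affine x1 y1) Origin = Affine x1 y1"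
| "point_add E (Affine x1 y1) (Affine x2 y2) =
     (let c1 = to_ac (a1 E); c2 = to_ac (a2 E); c3 = to_ac (a3 E); c4 = to_ac (a4 E)
      in if x1 = x2 \<and> y1 + y2 + c1 * x2 + c3 = 0 then Origin
         else
           let l = (if x1 = x2
                    then (3 * x1^2 + 2 * c2 * x1 + c4 - c1 * y1) / (2 * y1 + c1 * x1 + c3)
                    else (y2 - y1) / (x2 - x1));
               n = y1 - l * x1;
               x3 = l^2 + c1 * l - c2 - x1 - x2
           in Affine x3 (- (l + c1) * x3 - n - c3))"

fun hcoords :: "'a::field point \<Rightarrow> 'a \<times> 'a \<times> 'a" where
  "hcoords Origin = (0, 1, 0)"
| "hcoords (Affine x y) = (x, y, 1)"

text \<open>The form of degree \<open>d\<close> with coefficients \<open>c i j\<close> in the ground field.\<close>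

fun eval_form ::
  "nat \<Rightarrow> (nat \<Rightarrow> nat \<Rightarrow> 'k::field) \<Rightarrow> 'k alg_closure \<times> 'k alg_closure \<times> 'k alg_closure \<Rightarrow> 'k alg_closure"
where
  "eval_form d c (x, y, z) =
     (\<Sum>i\<le>d. \<Sum>j\<le>d - i. to_ac (c i j) * x^i * y^j * z^(d - i - j))"

text \<open>
  A map on geometric points is a morphism defined over \<open>k\<close> if near every point it is given, in
  homogeneous coordinates, by three forms of equal degree with coefficients in \<open>k\<close>.  The scalar \<open>s\<close>
  is zero exactly at the common zeros of the three forms.
\<close>

definition regular_map ::
  "'k::field weierstrass \<Rightarrow> ('k alg_closure point \<Rightarrow> 'k alg_closure point) \<Rightarrow> bool" where
  "regular_map E f \<longleftrightarrow>
     (\<forall>P\<in>points E. \<exists>d F G H.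
        (eval_form d F (hcoords P), eval_form d G (hcoords P), eval_form d H (hcoords P)) \<noteq> (0, 0, 0) \<and>
        (\<forall>Q\<in>points E. \<exists>s. case hcoords (f Q) of (x, y, z) \<Rightarrow>
           eval_form d F (hcoords Q) = s * x \<and>
           eval_form d G (hcoords Q) = s * y \<and>
           eval_form d H (hcoords Q) = s * z))"

definition endomorphisms ::
  "'k::field weierstrass \<Rightarrow> ('k alg_closure point \<Rightarrow> 'k alg_closure point) set" where
  "endomorphisms E = {f \<in> points E \<rightarrow>\<^sub>E points E. regular_map E f \<and>
     (\<forall>P\<in>points E. \<forall>Q\<in>points E. f (point_add E P Q) = point_add E (f P) (f Q))}"

definition End_ring ::
  "'k::field weierstrass \<Rightarrow> ('k alg_closure point \<Rightarrow> 'k alg_closure point) ring" where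
  "End_ring E = \<lparr>
     carrier = endomorphisms E,
     monoid.mult = (\<lambda>f g. compose (points E) f g),
     one = (\<lambda>P\<in>points E. P),
     ring.zero = (\<lambda>P\<in>points E. Origin),
     add = (\<lambda>f g. \<lambda>P\<in>points E. point_add E (f P) (g P))\<rparr>"

definition frobenius_endo ::
  "'k::{field,finite} weierstrass \<Rightarrow> 'k alg_closure point \<Rightarrow> 'k alg_closure point" where
  "frobenius_endo E = (\<lambda>P\<in>points E. map_point (\<lambda>x. x ^ CARD('k)) P)"

section \<open>Algebras over the rationals\<close>

text \<open>
  A \<open>\<rat>\<close>-algebra is a ring in which all positive integers are invertible; the algebra structure is
  unique.
\<close>

definition rat_algebra :: "('b, 'm) ring_scheme \<Rightarrow> bool" where
  "rat_algebra B \<longleftrightarrow> ring B \<and> (\<forall>n::nat. n > 0 \<longrightarrow> [n] \<cdot>\<^bsub>B\<^esub> \<one>\<^bsub>B\<^esub> \<in> Units B)"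

definition rat_scalar :: "('b, 'm) ring_scheme \<Rightarrow> rat \<Rightarrow> 'b" where
  "rat_scalar B r = (case quotient_of r of (m, n) \<Rightarrow>
     ([m] \<cdot>\<^bsub>B\<^esub> \<one>\<^bsub>B\<^esub>) \<otimes>\<^bsub>B\<^esub> inv\<^bsub>B\<^esub> ([n] \<cdot>\<^bsub>B\<^esub> \<one>\<^bsub>B\<^esub>))"

text \<open>
  \<open>B\<close> together with \<open>h : R \<rightarrow> B\<close>, \<open>f \<mapsto> f \<otimes> 1\<close>, is a model of \<open>R \<otimes> \<rat>\<close>, that is, of the localisation
  of \<open>R\<close> at the nonzero integers.  This determines \<open>(B, h)\<close> up to a unique isomorphism.
\<close>

definition is_rational_tensor ::
  "('a, 'm) ring_scheme \<Rightarrow> ('b, 'n) ring_scheme \<Rightarrow> ('a \<Rightarrow> 'b) \<Rightarrow> bool" where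
  "is_rational_tensor R B h \<longleftrightarrow>
     rat_algebra B \<and> h \<in> ring_hom R B \<and>
     (\<forall>b\<in>carrier B. \<exists>f\<in>carrier R. \<exists>n::nat. n > 0 \<and> [n] \<cdot>\<^bsub>B\<^esub> b = h f) \<and>
     (\<forall>f\<in>carrier R. h f = \<zero>\<^bsub>B\<^esub> \<longrightarrow> (\<exists>n::nat. n > 0 \<and> [n] \<cdot>\<^bsub>R\<^esub> f = \<zero>\<^bsub>R\<^esub>))"

definition quaternion_algebra :: "('b, 'm) ring_scheme \<Rightarrow> bool" where
  "quaternion_algebra B \<longleftrightarrow> rat_algebra B \<and>
     (\<exists>a b i j. a \<noteq> 0 \<and> b \<noteq> 0 \<and> i \<in> carrier B \<and> j \<in> carrier B \<and>
        i \<otimes>\<^bsub>B\<^esub> i = rat_scalar B a \<and> j \<otimes>\<^bsub>B\<^esub> j = rat_scalar B b \<and>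
        j \<otimes>\<^bsub>B\<^esub> i = \<ominus>\<^bsub>B\<^esub> (i \<otimes>\<^bsub>B\<^esub> j) \<and>
        bij_betw (\<lambda>(p, q, r, s). rat_scalar B p \<oplus>\<^bsub>B\<^esub> rat_scalar B q \<otimes>\<^bsub>B\<^esub> i
            \<oplus>\<^bsub>B\<^esub> rat_scalar B r \<otimes>\<^bsub>B\<^esub> j \<oplus>\<^bsub>B\<^esub> rat_scalar B s \<otimes>\<^bsub>B\<^esub> (i \<otimes>\<^bsub>B\<^esub> j))
          UNIV (carrier B))"

text \<open>
  The trace-zero elements of a quaternion algebra, described without choosing a basis:
  zero and the non-scalars whose square is a scalar.
\<close>

definition pure_quaternions :: "('b, 'm) ring_scheme \<Rightarrow> 'b set" where
  "pure_quaternions B = {x \<in> carrier B. x \<otimes>\<^bsub>B\<^esub> x \<in> range (rat_scalar B) \<and>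
     (x \<in> range (rat_scalar B) \<longrightarrow> x = \<zero>\<^bsub>B\<^esub>)}"

definition quat_conj :: "('b, 'm) ring_scheme \<Rightarrow> 'b \<Rightarrow> 'b" where
  "quat_conj B x = (THE y. \<exists>r. \<exists>v\<in>pure_quaternions B.
     x = rat_scalar B r \<oplus>\<^bsub>B\<^esub> v \<and> y = rat_scalar B r \<ominus>\<^bsub>B\<^esub> v)"

definition nrd :: "('b, 'm) ring_scheme \<Rightarrow> 'b \<Rightarrow> rat" where
  "nrd B x = (THE r. x \<otimes>\<^bsub>B\<^esub> quat_conj B x = rat_scalar B r)"

section \<open>Involutions and spin structures\<close>

definition center :: "('b, 'm) ring_scheme \<Rightarrow> 'b set" where
  "center B = {z \<in> carrier B. \<forall>x\<in>carrier B. z \<otimes>\<^bsub>B\<^esub> x = x \<otimes>\<^bsub>B\<^esub> z}"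

definition involution_first_kind :: "('b, 'm) ring_scheme \<Rightarrow> ('b \<Rightarrow> 'b) \<Rightarrow> bool" where
  "involution_first_kind B \<sigma> \<longleftrightarrow>
     \<sigma> \<in> carrier B \<rightarrow> carrier B \<and>
     (\<forall>x\<in>carrier B. \<forall>y\<in>carrier B. \<sigma> (x \<oplus>\<^bsub>B\<^esub> y) = \<sigma> x \<oplus>\<^bsub>B\<^esub> \<sigma> y) \<and>
     (\<forall>x\<in>carrier B. \<forall>y\<in>carrier B. \<sigma> (x \<otimes>\<^bsub>B\<^esub> y) = \<sigma> y \<otimes>\<^bsub>B\<^esub> \<sigma> x) \<and>
     (\<forall>x\<in>carrier B. \<sigma> (\<sigma> x) = x) \<and>
     (\<forall>z\<in>center B. \<sigma> z = z)"

definition spinorial_type :: "('b, 'm) ring_scheme \<Rightarrow> bool" where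
  "spinorial_type B \<longleftrightarrow> (\<exists>\<sigma>. involution_first_kind B \<sigma> \<and> (\<exists>x\<in>carrier B. \<sigma> x \<noteq> x))"

text \<open>
  A splitting \<open>B \<otimes> \<complex> \<cong> M\<^sub>2(\<complex>)\<close>, given by its restriction to \<open>B\<close>.  As \<open>B \<otimes> \<complex>\<close> has dimension 4, the
  \<open>\<complex>\<close>-linear extension is an isomorphism as soon as it is surjective, which is the last clause
  (\<open>mat c ** M\<close> is the scalar multiple \<open>c M\<close>).
\<close>

definition complex_splitting :: "('b, 'm) ring_scheme \<Rightarrow> ('b \<Rightarrow> complex^2^2) \<Rightarrow> bool" where
  "complex_splitting B \<phi> \<longleftrightarrow>
     (\<forall>x\<in>carrier B. \<forall>y\<in>carrier B. \<phi> (x \<oplus>\<^bsub>B\<^esub> y) = \<phi> x + \<phi> y) \<and>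
     (\<forall>x\<in>carrier B. \<forall>y\<in>carrier B. \<phi> (x \<otimes>\<^bsub>B\<^esub> y) = \<phi> x ** \<phi> y) \<and>
     \<phi> \<one>\<^bsub>B\<^esub> = mat 1 \<and>
     (\<forall>M. \<exists>(n::nat) c x. (\<forall>i<n. x i \<in> carrier B) \<and> M = (\<Sum>i<n. mat (c i) ** \<phi> (x i)))"

text \<open>
  The last equation says that \<open>\<sigma>\<close> becomes the adjoint involution of the bilinear form with Gram matrix
  \<open>S\<close>, i.e. \<open>b (\<phi> (\<sigma> x) v) w = b v (\<phi> x w)\<close> for \<open>b v w = v\<^sup>T S w\<close>.  The type of an
  involution does not depend on the splitting field, and \<open>\<complex>\<close> splits every quaternion algebra over \<open>\<rat>\<close>.
\<close>

definition orthogonal_involution :: "('b, 'm) ring_scheme \<Rightarrow> ('b \<Rightarrow> 'b) \<Rightarrow> bool" where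
  "orthogonal_involution B \<sigma> \<longleftrightarrow>
     quaternion_algebra B \<and> involution_first_kind B \<sigma> \<and>
     (\<exists>\<phi> S. complex_splitting B \<phi> \<and> Finite_Cartesian_Product.transpose S = S \<and> invertible S \<and>
        (\<forall>x\<in>carrier B. Finite_Cartesian_Product.transpose (\<phi> (\<sigma> x)) ** S = S ** \<phi> x))"

text \<open>
  An orthogonal involution has the form \<open>\<sigma> = Int(u) \<circ> \<gamma>\<close>, where \<open>u\<close> is a unit with \<open>\<gamma>(u) = - u\<close>
  that is unique up to a factor in \<open>\<rat>\<^sup>*\<close>.  As \<open>u\<close> runs through these units, \<open>- nrd B u\<close> runs through all
  representatives of the square class \<open>disc \<sigma>\<close>, so a choice of \<open>u\<close> amounts to a choice of
  representative together with a root of \<open>X\<^sup>2 - \<delta>\<close> in \<open>B\<close>.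
\<close>

definition disc_unit :: "('b, 'm) ring_scheme \<Rightarrow> ('b \<Rightarrow> 'b) \<Rightarrow> 'b \<Rightarrow> bool" where
  "disc_unit B \<sigma> u \<longleftrightarrow> u \<in> Units B \<and> quat_conj B u = \<ominus>\<^bsub>B\<^esub> u \<and>
     (\<forall>x\<in>carrier B. \<sigma> x = u \<otimes>\<^bsub>B\<^esub> quat_conj B x \<otimes>\<^bsub>B\<^esub> inv\<^bsub>B\<^esub> u)"

section \<open>The even Clifford algebra and the spin cover\<close>

abbreviation rat_poly_ring :: "rat poly ring" where
  "rat_poly_ring \<equiv> ring_of_type_algebra"

text \<open>\<open>C\<^sup>+(B, \<sigma>) = \<rat>[X] / (X\<^sup>2 - \<delta>)\<close> with \<open>\<delta> = - nrd B u\<close>.\<close>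

definition even_clifford :: "('b, 'm) ring_scheme \<Rightarrow> 'b \<Rightarrow> rat poly set ring" where
  "even_clifford B u = rat_poly_ring Quot (PIdl\<^bsub>rat_poly_ring\<^esub> [: nrd B u, 0, 1 :])"

definition eval_at :: "('b, 'm) ring_scheme \<Rightarrow> 'b \<Rightarrow> rat poly \<Rightarrow> 'b" where
  "eval_at B u f =
     finsum B (\<lambda>n. rat_scalar B (Polynomial.coeff f n) \<otimes>\<^bsub>B\<^esub> u [^]\<^bsub>B\<^esub> n) {..Polynomial.degree f}"

text \<open>The isomorphism of \<open>C\<^sup>+(B, \<sigma>)\<close> onto \<open>\<rat>(u) \<subseteq> B\<close> that maps the class of \<open>X\<close> to \<open>u\<close>.\<close>

definition clifford_embedding :: "('b, 'm) ring_scheme \<Rightarrow> 'b \<Rightarrow> rat poly set \<Rightarrow> 'b" where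
  "clifford_embedding B u C = the_elem (eval_at B u ` C)"

text \<open>The groups \<open>GO\<^sup>+(B, \<sigma>)\<close> and \<open>GSpin(B, \<sigma>)\<close> are represented by their groups of \<open>\<rat>\<close>-points.\<close>

definition GO_plus :: "('b, 'm) ring_scheme \<Rightarrow> ('b \<Rightarrow> 'b) \<Rightarrow> 'b monoid" where
  "GO_plus B \<sigma> = \<lparr>
     carrier = {g \<in> Units B. \<sigma> g \<otimes>\<^bsub>B\<^esub> g \<in> rat_scalar B ` (UNIV - {0}) \<and>
                             \<sigma> g \<otimes>\<^bsub>B\<^esub> g = rat_scalar B (nrd B g)},
     monoid.mult = monoid.mult B,
     one = \<one>\<^bsub>B\<^esub>\<rparr>"

definition GSpin :: "('b, 'm) ring_scheme \<Rightarrow> 'b \<Rightarrow> rat poly set monoid" where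
  "GSpin B u = units_of (even_clifford B u)"

definition spin_cover :: "('b, 'm) ring_scheme \<Rightarrow> 'b \<Rightarrow> rat poly set \<Rightarrow> 'b" where
  "spin_cover B u x = clifford_embedding B u (x \<otimes>\<^bsub>even_clifford B u\<^esub> x)"

section \<open>The Weil group and lifts\<close>

definition arith_frob :: "'k::{field,finite} alg_closure \<Rightarrow> 'k alg_closure" where
  "arith_frob x = x ^ CARD('k)"

definition weil_group :: "('k::{field,finite} alg_closure \<Rightarrow> 'k alg_closure) monoid" where
  "weil_group = (BijGroup UNIV)\<lparr>carrier := generate (BijGroup UNIV) {arith_frob}\<rparr>"

definition geom_frob :: "'k::{field,finite} alg_closure \<Rightarrow> 'k alg_closure" where
  "geom_frob = inv\<^bsub>weil_group\<^esub> arith_frob"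

text \<open>Here \<open>h\<close> is the map \<open>End_ring E \<rightarrow> B\<close>, so \<open>h (frobenius_endo E)\<close> is \<open>\<tau>\<close> as an element of \<open>B\<close>.\<close>

definition similitude_rep ::
  "'k::{field,finite} weierstrass \<Rightarrow> ('b, 'm) ring_scheme \<Rightarrow>
     (('k alg_closure point \<Rightarrow> 'k alg_closure point) \<Rightarrow> 'b) \<Rightarrow> ('b \<Rightarrow> 'b) \<Rightarrow>
     (('k alg_closure \<Rightarrow> 'k alg_closure) \<Rightarrow> 'b) \<Rightarrow> bool" where
  "similitude_rep E B h \<sigma> \<rho> \<longleftrightarrow>
     \<rho> \<in> hom weil_group (GO_plus B \<sigma>) \<and> \<rho> geom_frob = h (frobenius_endo E)"

definition spin_lift ::
  "('b, 'm) ring_scheme \<Rightarrow> 'b \<Rightarrow> (('k::{field,finite} alg_closure \<Rightarrow> 'k alg_closure) \<Rightarrow> 'b) \<Rightarrow>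
     (('k alg_closure \<Rightarrow> 'k alg_closure) \<Rightarrow> rat poly set) \<Rightarrow> bool" where
  "spin_lift B u \<rho> \<rho>' \<longleftrightarrow>
     \<rho>' \<in> hom weil_group (GSpin B u) \<and>
     (\<forall>w\<in>carrier weil_group. spin_cover B u (\<rho>' w) = \<rho> w)"

text \<open>For a curve of spinorial type \<open>\<tau>\<close> lies in the center \<open>\<rat>\<close> of \<open>B\<close>; this is its value in \<open>\<rat>\<close>.\<close>

definition frobenius_rat ::
  "'k::{field,finite} weierstrass \<Rightarrow> ('b, 'm) ring_scheme \<Rightarrow>
     (('k alg_closure point \<Rightarrow> 'k alg_closure point) \<Rightarrow> 'b) \<Rightarrow> rat" where
  "frobenius_rat E B h = (THE t. h (frobenius_endo E) = rat_scalar B t)"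

text \<open>
  The subfield \<open>\<rat>(\<surd>t)\<close> of \<open>\<complex>\<close>.  It is a quadratic field only if \<open>t\<close> is not a rational square.  If
  \<open>\<tau>\<close> is a rational square (as for \<open>\<tau> = p\<^sup>2\<close> over the field with \<open>p\<^sup>4\<close> elements), a lift exists for
  every \<open>\<sigma>\<close>, with values in \<open>\<rat>\<^sup>*\<close>, although \<open>C\<^sup>+(B, \<sigma>)\<close>, of dimension 2, is not \<open>\<rat>(\<surd>\<tau>) = \<rat>\<close>.
\<close>

definition rat_adjoin_sqrt :: "rat \<Rightarrow> complex ring" where
  "rat_adjoin_sqrt t =
     (let C = (ring_of_type_algebra :: complex ring)
      in C\<lparr>carrier := generate_field C {csqrt (of_rat t)}\<rparr>)"

end

theory Submission
  imports Defs "HOL-Number_Theory.Residues"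
begin

text \<open>
  The forms that define an endomorphism have coefficients in the ground field with \<open>q\<close> elements, so
  every endomorphism commutes with the Frobenius endomorphism (\<open>frobenius_endo_commutes\<close>).  Hence \<open>\<tau>\<close>
  is central in \<open>B\<close> (\<open>frobenius_central\<close>), and as the center of a quaternion algebra consists of the
  rational scalars (\<open>center_eq_rat_scalars\<close>), \<open>\<tau>\<close> is a rational number \<open>t\<close>.

  The Weil group is infinite cyclic, hence free on the geometric Frobenius.  A lift is therefore a
  unit \<open>x\<close> of the even Clifford algebra \<open>K = \<rat>[X] / (X\<^sup>2 + c)\<close>, \<open>c = Nrd(u)\<close>, whose square is mapped to
  \<open>\<tau>\<close>.  The map \<open>X \<mapsto> u\<close> embeds \<open>K\<close> into \<open>B\<close>, because \<open>u\<close> is a pure quaternion with \<open>u\<^sup>2 = - c\<close> and not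
  a scalar; so the condition on \<open>x\<close> is \<open>x\<^sup>2 = t\<close> inside \<open>K\<close> (\<open>spin_lift_exists_iff\<close>).

  There remains a question on quadratic algebras: for \<open>t\<close> not a rational square, \<open>t\<close> has a square root
  in \<open>K\<close> if and only if \<open>K\<close> is isomorphic to \<open>\<rat>(\<surd>t)\<close> (\<open>quadratic_algebra_adjoin_sqrt_iff\<close>).  An
  isomorphism transports \<open>\<surd>t\<close> into \<open>K\<close>.  Conversely, \<open>(a + b X)\<^sup>2 = t\<close> forces \<open>a b = 0\<close>; here \<open>b = 0\<close>
  would make \<open>t\<close> a square, so \<open>a = 0\<close> and \<open>t = - b\<^sup>2 c\<close>, and \<open>X \<mapsto> \<surd>t / b\<close> identifies \<open>K\<close> with \<open>\<rat>(\<surd>t)\<close>.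
\<close>

section \<open>Rational scalars\<close>

locale rational_algebra = ring B for B (structure) +
  assumes nat_Units: "n > (0::nat) \<Longrightarrow> [n] \<cdot> \<one> \<in> Units B"
begin

abbreviation int_scalar :: "int \<Rightarrow> 'a" where "int_scalar k \<equiv> [k] \<cdot> \<one>"

lemma int_scalar_closed [simp]: "int_scalar k \<in> carrier B"
  by simp

lemma int_scalar_commutes:
  assumes "x \<in> carrier B"
  shows "int_scalar k \<otimes> x = x \<otimes> int_scalar k"
  using assms by (simp add: add_pow_ldistr_int add_pow_rdistr_int)

lemma int_scalar_0: "int_scalar 0 = \<zero>"
  by (simp only: add_pow_int_ge order_refl nat_zero_as_int[symmetric] nat_0 add.nat_pow_0)

lemma int_scalar_1: "int_scalar 1 = \<one>"
  by (rule add.int_pow_1[OF one_closed])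

lemma int_scalar_add: "int_scalar (j + k) = int_scalar j \<oplus> int_scalar k"
  by (simp add: add.int_pow_mult)

lemma int_scalar_mult: "int_scalar (j * k) = int_scalar j \<otimes> int_scalar k"
proof -
  have "int_scalar j \<otimes> int_scalar k = [j] \<cdot> int_scalar k"
    by (simp add: add_pow_ldistr_int)
  also have "\<dots> = int_scalar (j * k)"
    by (simp add: add.int_pow_pow mult.commute)
  finally show ?thesis by simp
qed

lemma int_scalar_Units:
  assumes "k \<noteq> 0"
  shows "int_scalar k \<in> Units B"
proof (cases "k > 0")
  case True
  then have "int_scalar k = [nat k] \<cdot> \<one>"
    by (simp add: add_pow_int_ge)
  then show ?thesis using nat_Units True by simp
next
  case False
  define m where "m = nat (- k)"
  have m: "[m] \<cdot> \<one> \<in> Units B"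
    using nat_Units[of m] False assms by (simp add: m_def)
  have "int_scalar k = \<ominus> ([m] \<cdot> \<one>)"
    using False assms by (simp add: add_pow_int_lt m_def)
  also have "\<dots> = (\<ominus> \<one>) \<otimes> ([m] \<cdot> \<one>)"
    using Units_closed[OF m] by (simp only: l_minus l_one one_closed)
  also have "\<dots> \<in> Units B"
    using Units_minus_one_closed m by (rule Units_m_closed)
  finally show ?thesis .
qed

lemma int_scalar_cancel:
  assumes "k \<noteq> 0" "x \<in> carrier B" "y \<in> carrier B" "int_scalar k \<otimes> x = int_scalar k \<otimes> y"
  shows "x = y"
  using assms(4) Units_l_cancel[OF int_scalar_Units[OF assms(1)] assms(2,3)] by simp

lemma rat_scalar_closed [simp]: "rat_scalar B r \<in> carrier B"
proof (cases "quotient_of r")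
  case (Pair m n)
  then have "n \<noteq> 0" using quotient_of_denom_pos[of r m n] by simp
  then have "inv (int_scalar n) \<in> carrier B" using int_scalar_Units by blast
  then show ?thesis by (simp add: rat_scalar_def Pair)
qed

lemma int_scalar_rat_scalar:
  assumes "of_int k * r = of_int m"
  shows "int_scalar k \<otimes> rat_scalar B r = int_scalar m"
proof (cases "quotient_of r")
  case (Pair i n)
  have n: "n \<noteq> 0" using quotient_of_denom_pos[of r i n] Pair by simp
  have r: "r = of_int i / of_int n" using quotient_of_div[OF Pair] .
  have inv: "inv (int_scalar n) \<in> carrier B" "int_scalar n \<otimes> inv (int_scalar n) = \<one>"
    using int_scalar_Units[OF n] by auto
  have "of_int (k * i) = (of_int (m * n) :: rat)"
    using assms n unfolding r by (simp add: field_simps)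
  then have ki: "k * i = m * n" using of_int_eq_iff by blast
  have "int_scalar k \<otimes> rat_scalar B r = (int_scalar k \<otimes> int_scalar i) \<otimes> inv (int_scalar n)"
    using inv(1) by (simp add: rat_scalar_def Pair m_assoc)
  also have "\<dots> = int_scalar m \<otimes> (int_scalar n \<otimes> inv (int_scalar n))"
    using inv(1) by (simp only: int_scalar_mult[symmetric] ki)
      (simp only: int_scalar_mult m_assoc int_scalar_closed)
  finally show ?thesis using inv(2) by simp
qed

text \<open>
  A rational scalar is pinned down by clearing one denominator, so that identities between rational
  scalars reduce to identities between integers.
\<close>

lemma rat_scalar_eqI:
  assumes "k \<noteq> 0" "of_int k * r = of_int m" "y \<in> carrier B" "int_scalar k \<otimes> y = int_scalar m"
  shows "rat_scalar B r = y"
  by (rule int_scalar_cancel[OF assms(1) rat_scalar_closed assms(3)])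
     (simp only: int_scalar_rat_scalar[OF assms(2)] assms(4))

lemma rat_common_denominator:
  fixes r s :: rat
  obtains k m n where "k \<noteq> 0" "of_int k * r = of_int m" "of_int k * s = of_int n"
proof -
  obtain a b where r: "quotient_of r = (a, b)" by force
  obtain c d where s: "quotient_of s = (c, d)" by force
  have "b \<noteq> 0" "d \<noteq> 0"
    using quotient_of_denom_pos r s by (metis less_irrefl)+
  then show ?thesis
    using that[of "b * d" "a * d" "c * b"] quotient_of_div[OF r] quotient_of_div[OF s]
    by (simp add: field_simps)
qed

lemma rat_scalar_of_int: "rat_scalar B (of_int m) = int_scalar m"
proof (rule rat_scalar_eqI[of 1 _ m])
  show "int_scalar 1 \<otimes> int_scalar m = int_scalar m"
    by (simp only: int_scalar_mult[symmetric] mult_1)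
qed (rule one_neq_zero, simp only: of_int_1 mult_1, rule int_scalar_closed)

lemma rat_scalar_0 [simp]: "rat_scalar B 0 = \<zero>"
  using rat_scalar_of_int[of 0] by (simp only: of_int_0 int_scalar_0)

lemma rat_scalar_1 [simp]: "rat_scalar B 1 = \<one>"
  using rat_scalar_of_int[of 1] by (simp only: of_int_1 int_scalar_1)

lemma rat_scalar_add: "rat_scalar B (r + s) = rat_scalar B r \<oplus> rat_scalar B s"
proof -
  obtain k m n where *: "k \<noteq> 0" "of_int k * r = of_int m" "of_int k * s = of_int n"
    by (rule rat_common_denominator[of r s])
  show ?thesis
  proof (rule rat_scalar_eqI[of k _ "m + n"])
    show "int_scalar k \<otimes> (rat_scalar B r \<oplus> rat_scalar B s) = int_scalar (m + n)"
      using * by (simp only: r_distr int_scalar_closed rat_scalar_closed int_scalar_rat_scalar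
          int_scalar_add)
  qed (use * in \<open>simp_all add: algebra_simps\<close>)
qed

lemma rat_scalar_commutes:
  assumes x: "x \<in> carrier B"
  shows "rat_scalar B r \<otimes> x = x \<otimes> rat_scalar B r"
proof -
  obtain k m where *: "k \<noteq> 0" "of_int k * r = of_int m"
    by (rule rat_common_denominator[of r r])
  have "int_scalar k \<otimes> (rat_scalar B r \<otimes> x) = int_scalar m \<otimes> x"
    using x * by (simp only: m_assoc[symmetric] int_scalar_closed rat_scalar_closed int_scalar_rat_scalar)
  also have "\<dots> = (x \<otimes> int_scalar k) \<otimes> rat_scalar B r"
    using x * by (simp only: m_assoc int_scalar_closed rat_scalar_closed int_scalar_rat_scalar
        int_scalar_commutes[OF x])
  also have "\<dots> = int_scalar k \<otimes> (x \<otimes> rat_scalar B r)"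
    using x by (simp only: m_assoc int_scalar_closed rat_scalar_closed
        int_scalar_commutes[OF x, symmetric])
  finally show ?thesis
    by (rule int_scalar_cancel[OF *(1) m_closed[OF rat_scalar_closed x]
          m_closed[OF x rat_scalar_closed]])
qed

lemma rat_scalar_mult: "rat_scalar B (r * s) = rat_scalar B r \<otimes> rat_scalar B s"
proof -
  obtain k m n where *: "k \<noteq> 0" "of_int k * r = of_int m" "of_int k * s = of_int n"
    by (rule rat_common_denominator[of r s])
  show ?thesis
  proof (rule rat_scalar_eqI[of "k * k" _ "m * n"])
    have "int_scalar (k * k) \<otimes> (rat_scalar B r \<otimes> rat_scalar B s)
        = int_scalar k \<otimes> (int_scalar k \<otimes> rat_scalar B r) \<otimes> rat_scalar B s"
      by (simp only: int_scalar_mult m_assoc m_closed int_scalar_closed rat_scalar_closed)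
    also have "\<dots> = int_scalar m \<otimes> (int_scalar k \<otimes> rat_scalar B s)"
      using * by (simp only: int_scalar_rat_scalar int_scalar_commutes[of "int_scalar m" k]
          m_assoc m_closed int_scalar_closed rat_scalar_closed)
    finally show "int_scalar (k * k) \<otimes> (rat_scalar B r \<otimes> rat_scalar B s) = int_scalar (m * n)"
      using * by (simp only: int_scalar_rat_scalar int_scalar_mult)
  qed (use * in \<open>simp_all flip: *(2) *(3) add: ac_simps\<close>)
qed

lemma rat_scalar_minus: "rat_scalar B (- r) = \<ominus> rat_scalar B r"
proof -
  have "rat_scalar B (- r) \<oplus> rat_scalar B r = \<zero>"
    by (simp flip: rat_scalar_add)
  then show ?thesis by (simp add: minus_equality)
qed

lemma rat_scalar_left_commute:
  assumes "x \<in> carrier B" "y \<in> carrier B"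
  shows "x \<otimes> (rat_scalar B r \<otimes> y) = rat_scalar B r \<otimes> (x \<otimes> y)"
proof -
  have "x \<otimes> (rat_scalar B r \<otimes> y) = (x \<otimes> rat_scalar B r) \<otimes> y"
    by (rule m_assoc[symmetric]) (simp_all only: assms rat_scalar_closed)
  also have "\<dots> = (rat_scalar B r \<otimes> x) \<otimes> y"
    by (simp only: rat_scalar_commutes[OF assms(1)])
  also have "\<dots> = rat_scalar B r \<otimes> (x \<otimes> y)"
    by (rule m_assoc) (simp_all only: assms rat_scalar_closed)
  finally show ?thesis .
qed

section \<open>Evaluation of polynomials\<close>

lemma eval_at_upto:
  assumes u: "u \<in> carrier B" and N: "Polynomial.degree f \<le> N"
  shows "eval_at B u f = finsum B (\<lambda>n. rat_scalar B (Polynomial.coeff f n) \<otimes> u [^] n) {..N}"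
  unfolding eval_at_def
  by (rule add.finprod_mono_neutral_cong_left)
     (use u N in \<open>auto simp: Polynomial.coeff_eq_0\<close>)

lemma eval_at_closed [simp]: "u \<in> carrier B \<Longrightarrow> eval_at B u f \<in> carrier B"
  unfolding eval_at_def by (rule finsum_closed) auto

lemma eval_at_0 [simp]: "u \<in> carrier B \<Longrightarrow> eval_at B u 0 = \<zero>"
  by (simp add: eval_at_def)

lemma eval_at_pCons:
  assumes u: "u \<in> carrier B"
  shows "eval_at B u (pCons c f) = rat_scalar B c \<oplus> u \<otimes> eval_at B u f"
proof -
  let ?t = "\<lambda>f n. rat_scalar B (Polynomial.coeff f n) \<otimes> u [^] n"
  define N where "N = Polynomial.degree f"
  have "eval_at B u (pCons c f) = finsum B (?t (pCons c f)) {..Suc N}"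
    using u by (intro eval_at_upto) (auto simp: N_def degree_pCons_le)
  also have "\<dots> = finsum B (\<lambda>n. ?t (pCons c f) (Suc n)) {..N} \<oplus> rat_scalar B c"
    using u by (subst finsum_Suc2) auto
  also have "finsum B (\<lambda>n. ?t (pCons c f) (Suc n)) {..N} = finsum B (\<lambda>n. u \<otimes> ?t f n) {..N}"
    using u by (intro finsum_cong')
      (auto simp: rat_scalar_left_commute simp flip: nat_pow_Suc2)
  also have "\<dots> = u \<otimes> eval_at B u f"
    using u by (simp add: eval_at_def N_def finsum_rdistr)
  finally show ?thesis using u by (simp add: a_comm)
qed

lemma eval_at_const [simp]: "u \<in> carrier B \<Longrightarrow> eval_at B u [:c:] = rat_scalar B c"
  by (simp add: eval_at_pCons)

lemma eval_at_add:
  assumes u: "u \<in> carrier B"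
  shows "eval_at B u (f + g) = eval_at B u f \<oplus> eval_at B u g"
proof (induction f g rule: poly_induct2)
  case (pCons c f d g)
  show ?case
    using u by (simp add: eval_at_pCons pCons.IH rat_scalar_add r_distr a_ac)
qed (use u in auto)

lemma eval_at_smult:
  assumes u: "u \<in> carrier B"
  shows "eval_at B u (Polynomial.smult c f) = rat_scalar B c \<otimes> eval_at B u f"
proof (induction f)
  case (pCons d f)
  then show ?case
    using u by (simp add: eval_at_pCons rat_scalar_mult r_distr rat_scalar_left_commute)
qed (use u in auto)

lemma eval_at_mult:
  assumes u: "u \<in> carrier B"
  shows "eval_at B u (f * g) = eval_at B u f \<otimes> eval_at B u g"
proof (induction f)
  case (pCons c f)
  then show ?case
    using u by (simp add: eval_at_pCons eval_at_add eval_at_smult l_distr m_assoc)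
qed (use u in auto)

lemma eval_at_ring_hom:
  assumes "u \<in> carrier B"
  shows "eval_at B u \<in> ring_hom rat_poly_ring B"
proof (rule ring_hom_memI)
  have "eval_at B u 1 = \<one>"
    using eval_at_const[OF assms, of 1] by (simp only: one_pCons[symmetric] rat_scalar_1)
  then show "eval_at B u \<one>\<^bsub>rat_poly_ring\<^esub> = \<one>"
    by (simp add: ring_of_type_algebra_def)
qed (use assms in \<open>simp_all add: ring_of_type_algebra_def eval_at_add eval_at_mult\<close>)

end

section \<open>Quaternion algebras in coordinates\<close>

locale quaternion_basis = rational_algebra B for B (structure) +
  fixes a b :: rat and i j :: 'a
  assumes ab_nonzero: "a \<noteq> 0" "b \<noteq> 0"
    and ij_closed [simp]: "i \<in> carrier B" "j \<in> carrier B"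
    and i_square: "i \<otimes> i = rat_scalar B a"
    and j_square: "j \<otimes> j = rat_scalar B b"
    and ji: "j \<otimes> i = \<ominus> (i \<otimes> j)"
    and basis: "bij_betw (\<lambda>(p, q, r, s). rat_scalar B p \<oplus> rat_scalar B q \<otimes> i
            \<oplus> rat_scalar B r \<otimes> j \<oplus> rat_scalar B s \<otimes> (i \<otimes> j)) UNIV (carrier B)"
begin

definition quat :: "rat \<Rightarrow> rat \<Rightarrow> rat \<Rightarrow> rat \<Rightarrow> 'a" where
  "quat p q r s = rat_scalar B p \<oplus> rat_scalar B q \<otimes> i
            \<oplus> rat_scalar B r \<otimes> j \<oplus> rat_scalar B s \<otimes> (i \<otimes> j)"

lemma quat_closed [simp]: "quat p q r s \<in> carrier B"
  by (simp add: quat_def)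

lemma quat_cases:
  assumes "x \<in> carrier B"
  obtains p q r s where "x = quat p q r s"
proof -
  have "x \<in> (\<lambda>(p, q, r, s). quat p q r s) ` UNIV"
    using basis assms unfolding bij_betw_def quat_def by simp
  then show ?thesis using that by auto
qed

lemma quat_eq_iff [simp]:
  "quat p q r s = quat p' q' r' s' \<longleftrightarrow> p = p' \<and> q = q' \<and> r = r' \<and> s = s'"
proof -
  have "inj (\<lambda>(p, q, r, s). quat p q r s)"
    using basis unfolding bij_betw_def quat_def by simp
  from inj_eq[OF this, of "(p, q, r, s)" "(p', q', r', s')"] show ?thesis by simp
qed

lemma rat_scalar_quat: "rat_scalar B p = quat p 0 0 0"
  by (simp add: quat_def)

lemma zero_quat: "\<zero> = quat 0 0 0 0"
  by (simp add: quat_def)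

lemma quat_add: "quat p q r s \<oplus> quat p' q' r' s' = quat (p + p') (q + q') (r + r') (s + s')"
  by (simp add: quat_def rat_scalar_add l_distr a_ac)

lemma rat_scalar_mult_quat: "rat_scalar B c \<otimes> quat p q r s = quat (c * p) (c * q) (c * r) (c * s)"
  by (simp add: quat_def rat_scalar_mult r_distr m_assoc)

lemma quat_minus: "\<ominus> quat p q r s = quat (- p) (- q) (- r) (- s)"
  by (rule minus_equality) (simp_all add: quat_add zero_quat)

lemma i_mult_quat: "i \<otimes> quat p q r s = quat (a * q) p (a * s) r"
proof -
  have iij: "i \<otimes> (i \<otimes> j) = rat_scalar B a \<otimes> j"
    by (simp add: m_assoc[symmetric] i_square)
  have "i \<otimes> quat p q r s = rat_scalar B p \<otimes> i \<oplus> rat_scalar B q \<otimes> rat_scalar B a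
      \<oplus> rat_scalar B r \<otimes> (i \<otimes> j) \<oplus> rat_scalar B s \<otimes> (rat_scalar B a \<otimes> j)"
    by (simp add: quat_def r_distr rat_scalar_left_commute[of i] i_square iij
        rat_scalar_commutes[of i, symmetric])
  also have "\<dots> = rat_scalar B p \<otimes> i \<oplus> rat_scalar B (q * a)
      \<oplus> rat_scalar B r \<otimes> (i \<otimes> j) \<oplus> rat_scalar B (s * a) \<otimes> j"
    by (simp only: rat_scalar_mult m_assoc rat_scalar_closed ij_closed m_closed)
  also have "\<dots> = quat (a * q) p (a * s) r"
    by (simp add: quat_def a_ac mult.commute[of a])
  finally show ?thesis .
qed

lemma j_mult_quat: "j \<otimes> quat p q r s = quat (b * r) (- (b * s)) p (- q)"
proof -
  have jij: "j \<otimes> (i \<otimes> j) = rat_scalar B (- b) \<otimes> i"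
  proof -
    have "j \<otimes> (i \<otimes> j) = \<ominus> (i \<otimes> (j \<otimes> j))"
      by (simp add: m_assoc[symmetric] ji l_minus)
    then show ?thesis
      by (simp add: j_square rat_scalar_minus l_minus rat_scalar_commutes)
  qed
  have ji': "j \<otimes> i = rat_scalar B (- 1) \<otimes> (i \<otimes> j)"
    by (simp add: ji rat_scalar_minus l_minus)
  have "j \<otimes> quat p q r s = rat_scalar B p \<otimes> j \<oplus> rat_scalar B q \<otimes> (rat_scalar B (- 1) \<otimes> (i \<otimes> j))
      \<oplus> rat_scalar B r \<otimes> rat_scalar B b \<oplus> rat_scalar B s \<otimes> (rat_scalar B (- b) \<otimes> i)"
    by (simp add: quat_def r_distr rat_scalar_left_commute[of j] j_square jij ji'
        rat_scalar_commutes[of j, symmetric])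
  also have "\<dots> = rat_scalar B p \<otimes> j \<oplus> rat_scalar B (q * - 1) \<otimes> (i \<otimes> j)
      \<oplus> rat_scalar B (r * b) \<oplus> rat_scalar B (s * - b) \<otimes> i"
    by (simp only: rat_scalar_mult m_assoc rat_scalar_closed ij_closed m_closed)
  also have "\<dots> = quat (b * r) (- (b * s)) p (- q)"
    by (simp add: quat_def a_ac mult.commute[of b])
  finally show ?thesis .
qed

text \<open>
  Once the product is known in coordinates, statements about the algebra become polynomial identities
  over the rationals.  The left multiplications by \<open>i\<close> and \<open>j\<close> determine it.
\<close>

lemma quat_mult:
  "quat p q r s \<otimes> quat p' q' r' s' =
     quat (p * p' + a * q * q' + b * r * r' - a * b * s * s')
       (p * q' + q * p' - b * r * s' + b * s * r')
       (p * r' + r * p' + a * q * s' - a * s * q')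
       (p * s' + s * p' + q * r' - r * q')"
proof -
  let ?y = "quat p' q' r' s'"
  have "quat p q r s \<otimes> ?y = rat_scalar B p \<otimes> ?y \<oplus> rat_scalar B q \<otimes> (i \<otimes> ?y)
      \<oplus> rat_scalar B r \<otimes> (j \<otimes> ?y) \<oplus> rat_scalar B s \<otimes> (i \<otimes> (j \<otimes> ?y))"
    unfolding quat_def[of p q r s] by (simp add: l_distr m_assoc)
  then show ?thesis
    by (simp add: i_mult_quat j_mult_quat rat_scalar_mult_quat quat_add algebra_simps)
qed

text \<open>
  Commuting with \<open>i\<close> kills the coordinates of \<open>j\<close> and \<open>i j\<close>, and commuting with \<open>j\<close> kills that of \<open>i\<close>.
\<close>

lemma center_eq_rat_scalars: "center B = range (rat_scalar B)"
proof
  show "center B \<subseteq> range (rat_scalar B)"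
  proof
    fix z assume z: "z \<in> center B"
    then obtain p q r s where pqrs: "z = quat p q r s"
      unfolding center_def using quat_cases by blast
    have "quat 0 1 0 0 \<in> carrier B" "quat 0 0 1 0 \<in> carrier B"
      by simp_all
    then have "z \<otimes> quat 0 1 0 0 = quat 0 1 0 0 \<otimes> z" "z \<otimes> quat 0 0 1 0 = quat 0 0 1 0 \<otimes> z"
      using z by (auto simp: center_def)
    then have "q = 0 \<and> r = 0 \<and> s = 0"
      unfolding pqrs quat_mult using ab_nonzero by simp
    then show "z \<in> range (rat_scalar B)"
      by (simp add: pqrs rat_scalar_quat)
  qed
  show "range (rat_scalar B) \<subseteq> center B"
    by (auto simp: center_def rat_scalar_commutes)
qed

text \<open>
  The square of \<open>p + v\<close>, where \<open>v\<close> has no scalar part, is a scalar plus \<open>2 p v\<close>.  This makes the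
  basis-free description of pure quaternions agree with the coordinate one.
\<close>

lemma quat_in_pure_iff: "quat p q r s \<in> pure_quaternions B \<longleftrightarrow> p = 0"
  by (auto simp: pure_quaternions_def quat_mult rat_scalar_quat zero_quat image_iff)

lemma quat_conj_quat: "quat_conj B (quat p q r s) = quat p (- q) (- r) (- s)"
  unfolding quat_conj_def
proof (rule the_equality)
  show "\<exists>c. \<exists>v\<in>pure_quaternions B. quat p q r s = rat_scalar B c \<oplus> v \<and>
          quat p (- q) (- r) (- s) = rat_scalar B c \<ominus> v"
    by (rule exI[of _ p], rule bexI[of _ "quat 0 q r s"])
       (simp_all add: rat_scalar_quat a_minus_def quat_minus quat_add quat_in_pure_iff)
next
  fix y assume "\<exists>c. \<exists>v\<in>pure_quaternions B. quat p q r s = rat_scalar B c \<oplus> v \<and> y = rat_scalar B c \<ominus> v"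
  then obtain c v where v: "v \<in> pure_quaternions B" "quat p q r s = rat_scalar B c \<oplus> v"
    "y = rat_scalar B c \<ominus> v" by blast
  obtain p' q' r' s' where v': "v = quat p' q' r' s'"
    using v(1) quat_cases unfolding pure_quaternions_def by blast
  show "y = quat p (- q) (- r) (- s)"
    using v(1,2) unfolding v(3) v'
    by (simp add: rat_scalar_quat a_minus_def quat_minus quat_add quat_in_pure_iff)
qed

text \<open>
  An element \<open>u\<close> with \<open>\<gamma>(u) = - u\<close> has no scalar part, hence satisfies \<open>u\<^sup>2 = - Nrd(u)\<close>.
\<close>

lemma anti_selfconjugate_square:
  assumes u: "u \<in> carrier B" and conj: "quat_conj B u = \<ominus> u"
  shows "u \<otimes> u = rat_scalar B (- nrd B u)"
proof -
  obtain p q r s where u': "u = quat p q r s"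
    using quat_cases[OF u] .
  have "nrd B u = - (a * q * q + b * r * r - a * b * s * s)"
    unfolding nrd_def
  proof (rule the_equality)
    show "u \<otimes> quat_conj B u = rat_scalar B (- (a * q * q + b * r * r - a * b * s * s))"
      using conj by (simp add: u' quat_conj_quat quat_minus quat_mult rat_scalar_quat)
    then show "c = - (a * q * q + b * r * r - a * b * s * s)"
      if "u \<otimes> quat_conj B u = rat_scalar B c" for c
      using that by (simp add: rat_scalar_quat)
  qed
  then show ?thesis
    using conj by (simp add: u' quat_conj_quat quat_minus quat_mult rat_scalar_quat)
qed

text \<open>
  A nonzero \<open>u\<close> with \<open>\<gamma>(u) = - u\<close> is a pure quaternion, hence not a rational scalar.
\<close>

lemma anti_selfconjugate_independent:
  assumes u: "u \<in> carrier B" "u \<noteq> \<zero>" and conj: "quat_conj B u = \<ominus> u"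
    and eq: "rat_scalar B c \<oplus> u \<otimes> rat_scalar B d = \<zero>"
  shows "c = 0 \<and> d = 0"
proof -
  obtain p q r s where u': "u = quat p q r s"
    using quat_cases[OF u(1)] .
  show ?thesis
    using assms(2-)
    by (auto simp: u' quat_conj_quat quat_minus quat_mult quat_add rat_scalar_quat zero_quat)
qed

lemma rat_scalar_inject [simp]: "rat_scalar B c = rat_scalar B d \<longleftrightarrow> c = d"
  by (simp add: rat_scalar_quat)

end

lemma quaternion_algebra_basis:
  assumes "quaternion_algebra B"
  obtains a b i j where "quaternion_basis B a b i j"
  using assms unfolding quaternion_algebra_def rat_algebra_def quaternion_basis_def
    rational_algebra_def rational_algebra_axioms_def quaternion_basis_axioms_def
  by metis

section \<open>The quadratic algebra \<open>\<rat>[X] / (X\<^sup>2 + c)\<close>\<close>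

lemma rat_poly_ring_sel [simp]:
  "carrier rat_poly_ring = UNIV" "f \<otimes>\<^bsub>rat_poly_ring\<^esub> g = f * g" "f \<oplus>\<^bsub>rat_poly_ring\<^esub> g = f + g"
  "\<one>\<^bsub>rat_poly_ring\<^esub> = 1" "\<zero>\<^bsub>rat_poly_ring\<^esub> = 0"
  by (simp_all add: ring_of_type_algebra_def)

interpretation rat_poly: cring rat_poly_ring
  by (rule cring_from_type_algebra)

lemma rat_poly_ring_uminus [simp]: "\<ominus>\<^bsub>rat_poly_ring\<^esub> f = - f"
  by (rule rat_poly.minus_equality) simp_all

lemma rat_poly_ring_minus [simp]: "f \<ominus>\<^bsub>rat_poly_ring\<^esub> g = f - g"
  by (simp add: a_minus_def)

definition quadratic_algebra :: "rat \<Rightarrow> rat poly set ring" where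
  "quadratic_algebra c = rat_poly_ring Quot (PIdl\<^bsub>rat_poly_ring\<^esub> [: c, 0, 1 :])"

definition residue_class :: "rat \<Rightarrow> rat poly \<Rightarrow> rat poly set" where
  "residue_class c f = PIdl\<^bsub>rat_poly_ring\<^esub> [: c, 0, 1 :] +>\<^bsub>rat_poly_ring\<^esub> f"

lemma even_clifford_quadratic: "even_clifford B u = quadratic_algebra (nrd B u)"
  by (simp add: even_clifford_def quadratic_algebra_def)

lemma in_PIdl_iff_dvd: "f \<in> PIdl\<^bsub>rat_poly_ring\<^esub> m \<longleftrightarrow> m dvd f"
  by (auto simp: cgenideal_def dvd_def mult.commute)

lemma PIdl_ideal: "ideal (PIdl\<^bsub>rat_poly_ring\<^esub> m) rat_poly_ring"
  by (rule rat_poly.cgenideal_ideal) simp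

lemma quadratic_algebra_cring: "cring (quadratic_algebra c)"
  unfolding quadratic_algebra_def
  using ideal.quotient_is_cring[OF PIdl_ideal rat_poly.is_cring] .

lemma residue_class_hom: "residue_class c \<in> ring_hom rat_poly_ring (quadratic_algebra c)"
  using ideal.rcos_ring_hom[OF PIdl_ideal] by (simp add: quadratic_algebra_def residue_class_def[abs_def])

lemma carrier_quadratic_algebra: "carrier (quadratic_algebra c) = range (residue_class c)"
  by (auto simp: quadratic_algebra_def residue_class_def FactRing_def A_RCOSETS_def')

lemma residue_class_mult:
  "residue_class c f \<otimes>\<^bsub>quadratic_algebra c\<^esub> residue_class c g = residue_class c (f * g)"
  using ring_hom_mult[OF residue_class_hom, of f g c] by simp

lemma residue_class_add:
  "residue_class c f \<oplus>\<^bsub>quadratic_algebra c\<^esub> residue_class c g = residue_class c (f + g)"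
  using ring_hom_add[OF residue_class_hom, of f g c] by simp

lemma residue_class_one: "\<one>\<^bsub>quadratic_algebra c\<^esub> = residue_class c 1"
  using ring_hom_one[OF residue_class_hom, of c] by simp

lemma residue_class_eq_iff: "residue_class c f = residue_class c g \<longleftrightarrow> [: c, 0, 1 :] dvd f - g"
  using rat_poly.quotient_eq_iff_same_a_r_cos[OF PIdl_ideal, of f g "[: c, 0, 1 :]"]
  by (simp add: residue_class_def in_PIdl_iff_dvd)

lemma monic_quadratic_remainder:
  fixes c :: rat
  obtains a b where "[: c, 0, 1 :] dvd f - [: a, b :]"
proof -
  let ?r = "f mod [: c, 0, 1 :]"
  have "?r = 0 \<or> Polynomial.degree ?r < 2"
    using degree_mod_less[of "[: c, 0, 1 :]" f] by (simp add: numeral_2_eq_2)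
  then have "Polynomial.degree ?r < 2"
    by auto
  then have "?r = [: Polynomial.coeff ?r 0, Polynomial.coeff ?r 1 :]"
    by (intro poly_eqI) (auto simp: coeff_pCons coeff_eq_0 split: nat.split)
  moreover have "[: c, 0, 1 :] dvd f - ?r"
    by (rule dvd_minus_mod)
  ultimately show ?thesis using that by metis
qed

lemma monic_quadratic_dvd_linear_iff:
  fixes c :: rat
  shows "[: c, 0, 1 :] dvd [: a, b :] \<longleftrightarrow> a = 0 \<and> b = 0"
proof
  assume "[: c, 0, 1 :] dvd [: a, b :]"
  then have "[: a, b :] = 0 \<or> Polynomial.degree [: c, 0, 1 :] \<le> Polynomial.degree [: a, b :]"
    using dvd_imp_degree_le by blast
  then show "a = 0 \<and> b = 0" by (auto split: if_splits)
qed simp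

text \<open>
  A homomorphism that kills \<open>X\<^sup>2 + c\<close> has exactly the kernel generated by it as soon as the images of
  \<open>1\<close> and \<open>X\<close> are independent.  Both realisations of the algebra, inside the quaternion algebra and
  inside the complex numbers, come from this fact.
\<close>

lemma quadratic_algebra_image:
  assumes S: "ring S" and \<phi>: "\<phi> \<in> ring_hom rat_poly_ring S"
    and root: "\<phi> [: c, 0, 1 :] = \<zero>\<^bsub>S\<^esub>"
    and indep: "\<And>a b. \<phi> [: a, b :] = \<zero>\<^bsub>S\<^esub> \<Longrightarrow> a = 0 \<and> b = 0"
  shows "(\<lambda>C. the_elem (\<phi> ` C)) \<in> ring_iso (quadratic_algebra c) (S\<lparr>carrier := range \<phi>\<rparr>)"
    and "the_elem (\<phi> ` residue_class c f) = \<phi> f"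
proof -
  interpret \<phi>: ring_hom_ring rat_poly_ring S \<phi>
    using rat_poly.ring_axioms S \<phi> by (rule ring_hom_ringI2)
  have mult_zero: "\<phi> ([: c, 0, 1 :] * g) = \<zero>\<^bsub>S\<^esub>" for g
    using \<phi>.hom_mult[of "[: c, 0, 1 :]" g] \<phi>.hom_closed[of g] by (simp add: root)
  have kernel: "a_kernel rat_poly_ring S \<phi> = PIdl\<^bsub>rat_poly_ring\<^esub> [: c, 0, 1 :]"
  proof (intro equalityI subsetI)
    fix f assume "f \<in> a_kernel rat_poly_ring S \<phi>"
    then have f: "\<phi> f = \<zero>\<^bsub>S\<^esub>" unfolding a_kernel_def' by blast
    obtain a b where "[: c, 0, 1 :] dvd f - [: a, b :]"
      using monic_quadratic_remainder .
    then obtain g where "f - [: a, b :] = [: c, 0, 1 :] * g"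
      by (rule dvdE)
    then have g: "f = [: c, 0, 1 :] * g + [: a, b :]"
      by (simp only: diff_eq_eq)
    have "\<phi> f = \<phi> [: a, b :]"
      using \<phi>.hom_add[of "[: c, 0, 1 :] * g" "[: a, b :]"] \<phi>.hom_closed[of "[: a, b :]"]
      unfolding g by (simp add: mult_zero del: mult_pCons_left)
    then have "a = 0 \<and> b = 0" using f indep by simp
    then show "f \<in> PIdl\<^bsub>rat_poly_ring\<^esub> [: c, 0, 1 :]"
      using g by (simp add: in_PIdl_iff_dvd del: mult_pCons_left)
  next
    fix f assume "f \<in> PIdl\<^bsub>rat_poly_ring\<^esub> [: c, 0, 1 :]"
    then have "[: c, 0, 1 :] dvd f" by (simp only: in_PIdl_iff_dvd)
    then obtain g where "f = [: c, 0, 1 :] * g" by (rule dvdE)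
    then have "\<phi> f = \<zero>\<^bsub>S\<^esub>" by (simp only: mult_zero)
    then show "f \<in> a_kernel rat_poly_ring S \<phi>" unfolding a_kernel_def'
      by (simp only: mem_Collect_eq rat_poly_ring_sel UNIV_I simp_thms)
  qed
  show "(\<lambda>C. the_elem (\<phi> ` C)) \<in> ring_iso (quadratic_algebra c) (S\<lparr>carrier := range \<phi>\<rparr>)"
    using \<phi>.FactRing_iso_set_aux by (simp add: kernel quadratic_algebra_def)
  show "the_elem (\<phi> ` residue_class c f) = \<phi> f"
    using \<phi>.the_elem_simp[of f] by (simp add: kernel residue_class_def)
qed

section \<open>Square roots of rational numbers in a quadratic algebra\<close>

text \<open>
  If \<open>(a + b X)\<^sup>2 = t\<close> modulo \<open>X\<^sup>2 + c\<close>, then \<open>2 a b = 0\<close>.  As \<open>t\<close> is not a rational square, \<open>b\<close>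
  cannot vanish, so \<open>a = 0\<close>, and the root is a rational multiple of the class of \<open>X\<close>.
\<close>

lemma square_root_in_quadratic_algebra:
  assumes x: "x \<in> carrier (quadratic_algebra c)"
    and sq: "x \<otimes>\<^bsub>quadratic_algebra c\<^esub> x = residue_class c [: t :]"
    and nonsquare: "\<And>a. a * a \<noteq> t"
  obtains b where "b \<noteq> 0" "t = - (b * b * c)"
proof -
  obtain f where f: "x = residue_class c f"
    using x by (auto simp: carrier_quadratic_algebra)
  obtain a b where "[: c, 0, 1 :] dvd f - [: a, b :]"
    using monic_quadratic_remainder .
  then have "x = residue_class c [: a, b :]"
    by (simp add: f residue_class_eq_iff)
  then have dvd: "[: c, 0, 1 :] dvd [: a, b :] * [: a, b :] - [: t :]"
    using sq by (simp add: residue_class_mult residue_class_eq_iff del: mult_pCons_left)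
  have "[: a, b :] * [: a, b :] - [: t :]
      = [: a * a - b * b * c - t, 2 * (a * b) :] + Polynomial.smult (b * b) [: c, 0, 1 :]"
    by simp
  then have "[: c, 0, 1 :] dvd [: a * a - b * b * c - t, 2 * (a * b) :]"
    using dvd by (metis dvd_add_left_iff dvd_smult dvd_refl)
  then have *: "a * a - b * b * c - t = 0" "a * b = 0"
    by (simp_all add: monic_quadratic_dvd_linear_iff)
  have "b \<noteq> 0" using *(1) nonsquare[of a] by auto
  then show ?thesis using that[of b] * by auto
qed

section \<open>The field \<open>\<rat>(\<surd>t)\<close> inside the complex numbers\<close>

abbreviation complex_ring :: "complex ring" where
  "complex_ring \<equiv> ring_of_type_algebra"

lemma complex_ring_sel [simp]:
  "carrier complex_ring = UNIV" "x \<otimes>\<^bsub>complex_ring\<^esub> y = x * y" "x \<oplus>\<^bsub>complex_ring\<^esub> y = x + y"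
  "\<one>\<^bsub>complex_ring\<^esub> = 1" "\<zero>\<^bsub>complex_ring\<^esub> = 0"
  by (simp_all add: ring_of_type_algebra_def)

interpretation cpx: cring complex_ring
  by (rule cring_from_type_algebra)

lemma complex_ring_uminus [simp]: "\<ominus>\<^bsub>complex_ring\<^esub> x = - x"
  by (rule cpx.minus_equality) simp_all

lemma complex_ring_inv: "x \<noteq> 0 \<Longrightarrow> inv\<^bsub>complex_ring\<^esub> x = inverse x"
  by (rule cpx.comm_inv_char) simp_all

lemma complex_ring_add_pow_nat: "[(n::nat)] \<cdot>\<^bsub>complex_ring\<^esub> 1 = of_nat n"
proof (induction n)
  case (Suc n)
  then show ?case using cpx.add.nat_pow_Suc[of 1 n] by simp
next
  case 0
  show ?case using cpx.add.nat_pow_0[of 1] by simp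
qed

lemma complex_ring_add_pow_int: "[(k::int)] \<cdot>\<^bsub>complex_ring\<^esub> 1 = of_int k"
proof (cases "k \<ge> 0")
  case True
  then show ?thesis by (simp add: add_pow_int_ge complex_ring_add_pow_nat)
next
  case False
  then show ?thesis by (simp add: add_pow_int_lt complex_ring_add_pow_nat)
qed

interpretation cpx: rational_algebra complex_ring
proof unfold_locales
  fix n :: nat assume "n > 0"
  then have "of_nat n * inverse (of_nat n) = (1::complex)"
    by simp
  then show "[n] \<cdot>\<^bsub>complex_ring\<^esub> \<one>\<^bsub>complex_ring\<^esub> \<in> Units complex_ring"
    unfolding Units_def
    by (auto simp: complex_ring_add_pow_nat mult.commute intro!: exI[of _ "inverse (of_nat n)"])
qed

lemma complex_ring_rat_scalar: "rat_scalar complex_ring r = of_rat r"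
proof -
  obtain k m where *: "k \<noteq> 0" "of_int k * r = of_int m"
    by (rule cpx.rat_common_denominator[of r r])
  show ?thesis
  proof (rule cpx.rat_scalar_eqI[OF *])
    have "of_rat (of_int k * r) = (of_rat (of_int m) :: complex)"
      using *(2) by simp
    then show "[k] \<cdot>\<^bsub>complex_ring\<^esub> \<one>\<^bsub>complex_ring\<^esub> \<otimes>\<^bsub>complex_ring\<^esub> of_rat r
        = [m] \<cdot>\<^bsub>complex_ring\<^esub> \<one>\<^bsub>complex_ring\<^esub>"
      by (simp add: complex_ring_add_pow_int of_rat_mult)
  qed simp
qed

lemma irrational_independent:
  fixes z :: complex
  assumes z: "z \<notin> \<rat>" and eq: "of_rat a + of_rat b * z = 0"
  shows "a = 0 \<and> b = 0"
proof -
  have "b = 0"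
  proof (rule ccontr)
    assume "b \<noteq> 0"
    then have "z = of_rat (- a / b)"
      using eq by (simp add: of_rat_divide of_rat_minus field_simps eq_neg_iff_add_eq_0)
    then show False using z by simp
  qed
  then show ?thesis using eq by simp
qed

lemma of_rat_in_generate_field: "of_rat r \<in> generate_field complex_ring H"
proof -
  have nat: "of_nat (Suc n) \<in> generate_field complex_ring H" for n
  proof (induction n)
    case (Suc n)
    from generate_field.eng_add[OF generate_field.one[of complex_ring H] Suc.IH] show ?case by simp
  qed (use generate_field.one[of complex_ring H] in simp)
  have zero: "0 \<in> generate_field complex_ring H"
    using generate_field.eng_add[OF nat[of 0] generate_field.a_inv[OF nat[of 0]]] by simp
  have int: "of_int k \<in> generate_field complex_ring H" for k
  proof (cases k rule: int_cases3)
    case (pos n)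
    then show ?thesis using nat[of "n - 1"] by simp
  next
    case (neg n)
    then show ?thesis using generate_field.a_inv[OF nat[of "n - 1"]] by simp
  qed (use zero in simp)
  obtain m n where r: "quotient_of r = (m, n)" by force
  then have n: "n \<noteq> 0" using quotient_of_denom_pos by (metis less_irrefl)
  have "of_int m * inverse (of_int n) \<in> generate_field complex_ring H"
    using generate_field.eng_mult[OF int[of m] generate_field.m_inv[OF int[of n]]] n
    by (simp add: complex_ring_inv)
  then show ?thesis
    using quotient_of_div[OF r] by (simp add: divide_inverse of_rat_mult of_rat_inverse)
qed

text \<open>
  The set \<open>\<rat> + \<rat> s\<close> is closed under the field operations; inverses come from the conjugate
  \<open>a - b s\<close>.
\<close>

lemma generate_field_square_root:
  fixes s :: complex
  assumes s: "s \<notin> \<rat>" and sq: "s * s = of_rat t"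
  shows "generate_field complex_ring {s} = range (\<lambda>(a, b). of_rat a + of_rat b * s)"
proof (intro equalityI subsetI)
  let ?L = "range (\<lambda>(a, b). of_rat a + of_rat b * s)"
  have LI: "of_rat a + of_rat b * s \<in> ?L" for a b
    by (rule range_eqI[of _ _ "(a, b)"]) simp
  fix x assume "x \<in> generate_field complex_ring {s}"
  then show "x \<in> ?L"
  proof (induction rule: generate_field.induct)
    case one
    show ?case using LI[of 1 0] by simp
  next
    case (incl x)
    then show ?case using LI[of 0 1] by simp
  next
    case (a_inv x)
    then obtain a b where "x = of_rat a + of_rat b * s" by auto
    then show ?case using LI[of "- a" "- b"] by (simp add: of_rat_minus)
  next
    case (m_inv x)
    then obtain a b where x: "x = of_rat a + of_rat b * s" by auto
    \<comment> \<open>Like \<open>x\<close>, the conjugate \<open>a - b s\<close> is nonzero because \<open>s\<close> is irrational; so the norm \<open>N\<close> is nonzero.\<close>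
    define N where "N = a * a - b * b * t"
    have prod: "x * (of_rat a - of_rat b * s) = of_rat N"
      by (simp add: x N_def of_rat_diff of_rat_mult sq[symmetric] algebra_simps)
    have x0: "x \<noteq> 0" using m_inv by simp
    have "N \<noteq> 0"
    proof
      assume "N = 0"
      then have "of_rat a + of_rat (- b) * s = 0"
        using prod x0 by (simp add: of_rat_minus)
      then have "a = 0 \<and> - b = 0" using irrational_independent[OF s] by blast
      then show False using x0 x by simp
    qed
    then have "x * (of_rat (a / N) + of_rat (- b / N) * s) = 1"
      using prod by (simp add: of_rat_divide of_rat_minus field_simps)
    then have "inverse x = of_rat (a / N) + of_rat (- b / N) * s"
      by (rule inverse_unique)
    then show ?case using LI[of "a / N" "- b / N"] x0 by (simp add: complex_ring_inv)
  next
    case (eng_add x y)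
    then obtain a b c d where "x = of_rat a + of_rat b * s" "y = of_rat c + of_rat d * s" by auto
    then show ?case
      using LI[of "a + c" "b + d"] by (simp add: of_rat_add algebra_simps)
  next
    case (eng_mult x y)
    then obtain a b c d where "x = of_rat a + of_rat b * s" "y = of_rat c + of_rat d * s" by auto
    then show ?case
      using LI[of "a * c + b * d * t" "a * d + b * c"]
      by (simp add: of_rat_add of_rat_mult sq[symmetric] algebra_simps)
  qed
next
  fix x assume "x \<in> range (\<lambda>(a, b). of_rat a + of_rat b * s)"
  then obtain a b where x: "x = of_rat a + of_rat b * s" by auto
  have "s \<in> generate_field complex_ring {s}" by (simp add: generate_field.incl)
  from generate_field.eng_add[OF of_rat_in_generate_field[of a]
      generate_field.eng_mult[OF of_rat_in_generate_field[of b] this]]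
  show "x \<in> generate_field complex_ring {s}" by (simp add: x)
qed

lemma csqrt_irrational_not_square:
  assumes "csqrt (of_rat t) \<notin> \<rat>"
  shows "a * a \<noteq> t"
proof
  assume "a * a = t"
  then have "(csqrt (of_rat t))\<^sup>2 = (of_rat a)\<^sup>2"
    by (simp only: power2_csqrt) (simp add: power2_eq_square flip: of_rat_mult)
  then have "csqrt (of_rat t) = of_rat a \<or> csqrt (of_rat t) = of_rat (- a)"
    by (simp only: power2_eq_iff of_rat_minus)
  then show False using assms by (metis Rats_of_rat)
qed

lemma additive_rat_eq_of_rat:
  fixes g :: "rat \<Rightarrow> complex"
  assumes add: "\<And>r s. g (r + s) = g r + g s" and one: "g 1 = 1"
  shows "g r = of_rat r"
proof -
  have zero: "g 0 = 0" using add[of 0 0] by simp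
  have neg: "g (- r) = - g r" for r using add[of r "- r"] zero by (simp add: eq_neg_iff_add_eq_0 add.commute)
  have nat: "g (of_nat n * r) = of_nat n * g r" for n r
    by (induction n) (simp_all add: zero add distrib_right)
  have int: "g (of_int k * r) = of_int k * g r" for k r
  proof (cases "k \<ge> 0")
    case True
    then show ?thesis using nat[of "nat k" r] by simp
  next
    case False
    then show ?thesis using nat[of "nat (- k)" r] neg[of "of_int k * r"] by simp
  qed
  obtain m n where r: "quotient_of r = (m, n)" by force
  then have n: "n \<noteq> 0" using quotient_of_denom_pos by (metis less_irrefl)
  have rmn: "r = of_int m / of_int n" using quotient_of_div[OF r] .
  have "of_int n * g r = of_int m"
    using int[of n r] int[of m 1] n one by (simp add: rmn)
  then show ?thesis using n by (simp add: rmn of_rat_divide field_simps)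
qed

section \<open>When the quadratic algebra is \<open>\<rat>(\<surd>t)\<close>\<close>

text \<open>
  The number \<open>z = \<surd>t / b\<close> satisfies \<open>z\<^sup>2 = - c\<close>, so \<open>X \<mapsto> z\<close> realises the quadratic algebra inside \<open>\<complex>\<close>, and
  its image \<open>\<rat> + \<rat> z\<close> is \<open>\<rat> + \<rat> \<surd>t\<close>.
\<close>

lemma quadratic_algebra_iso_adjoin_sqrt:
  assumes irr: "csqrt (of_rat t) \<notin> \<rat>" and b: "b \<noteq> 0" and t: "t = - (b * b * c)"
  shows "quadratic_algebra c \<simeq> rat_adjoin_sqrt t"
proof -
  define s where "s = csqrt (of_rat t)"
  define z where "z = s * of_rat (inverse b)"
  have s: "s \<notin> \<rat>" "s * s = of_rat t"
    using irr power2_csqrt[of "of_rat t"] by (simp_all add: s_def power2_eq_square)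
  have sz: "s = z * of_rat b"
    using b by (simp add: z_def mult.assoc flip: of_rat_mult)
  have z: "z \<notin> \<rat>"
    using s(1) unfolding sz by auto
  have "z * z = of_rat (- c)"
  proof -
    have "z * z = (s * s) * of_rat (inverse b * inverse b)"
      by (simp add: z_def of_rat_mult)
    also have "\<dots> = of_rat (- c)"
    proof -
      have "t * (inverse b * inverse b) = - c" using b by (simp add: t field_simps)
      then show ?thesis by (simp only: s(2) of_rat_mult[symmetric])
    qed
    finally show ?thesis .
  qed
  let ?\<phi> = "eval_at complex_ring z"
  have linear: "?\<phi> [: a, d :] = of_rat a + of_rat d * z" for a d
    by (simp add: cpx.eval_at_pCons complex_ring_rat_scalar mult.commute)
  have "(\<lambda>C. the_elem (?\<phi> ` C)) \<in> ring_iso (quadratic_algebra c) (complex_ring\<lparr>carrier := range ?\<phi>\<rparr>)"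
  proof (rule quadratic_algebra_image(1))
    show "?\<phi> \<in> ring_hom rat_poly_ring complex_ring"
      by (rule cpx.eval_at_ring_hom) simp
    show root: "?\<phi> [: c, 0, 1 :] = \<zero>\<^bsub>complex_ring\<^esub>"
      using \<open>z * z = of_rat (- c)\<close>
      by (simp add: cpx.eval_at_pCons complex_ring_rat_scalar of_rat_minus)
    show "a = 0 \<and> d = 0" if "?\<phi> [: a, d :] = \<zero>\<^bsub>complex_ring\<^esub>" for a d
      using that irrational_independent[OF z, of a d] by (simp add: linear)
  qed (rule cpx.ring_axioms)
  moreover have "range ?\<phi> = generate_field complex_ring {s}"
  proof -
    have "range ?\<phi> = range (\<lambda>(a, d). of_rat a + of_rat d * s)"
    proof (intro equalityI subsetI)
      fix x assume "x \<in> range ?\<phi>"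
      then obtain f where f: "x = ?\<phi> f" by auto
      obtain a d where "[: c, 0, 1 :] dvd f - [: a, d :]"
        using monic_quadratic_remainder .
      then obtain g where "f - [: a, d :] = [: c, 0, 1 :] * g" by (rule dvdE)
      then have g: "f = [: c, 0, 1 :] * g + [: a, d :]" by (simp only: diff_eq_eq)
      have "?\<phi> [: c, 0, 1 :] = 0"
        using \<open>z * z = of_rat (- c)\<close>
        by (simp add: cpx.eval_at_pCons complex_ring_rat_scalar of_rat_minus)
      then have "x = of_rat a + of_rat d * z"
        unfolding f g by (simp add: cpx.eval_at_add cpx.eval_at_mult linear del: mult_pCons_left)
      also have "\<dots> = of_rat a + of_rat (d * inverse b) * s"
        by (simp add: z_def of_rat_mult)
      finally show "x \<in> range (\<lambda>(a, d). of_rat a + of_rat d * s)"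
        by (intro range_eqI[of _ _ "(a, d * inverse b)"]) simp
    next
      fix x assume "x \<in> range (\<lambda>(a, d). of_rat a + of_rat d * s)"
      then obtain a d where "x = of_rat a + of_rat d * s" by auto
      then have "x = ?\<phi> [: a, d * b :]"
        by (simp add: linear sz of_rat_mult)
      then show "x \<in> range ?\<phi>" by simp
    qed
    then show ?thesis using generate_field_square_root[OF s] by simp
  qed
  ultimately show ?thesis
    unfolding is_ring_iso_def rat_adjoin_sqrt_def Let_def s_def by auto
qed

text \<open>
  A ring isomorphism onto a field of characteristic \<open>0\<close> fixes the rational numbers, so the preimage of
  \<open>\<surd>t\<close> has square \<open>t\<close>.
\<close>

lemma adjoin_sqrt_iso_imp_square_root:
  assumes "quadratic_algebra c \<simeq> rat_adjoin_sqrt t"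
  obtains x where "x \<in> carrier (quadratic_algebra c)"
    "x \<otimes>\<^bsub>quadratic_algebra c\<^esub> x = residue_class c [: t :]"
proof -
  define s where "s = csqrt (of_rat t)"
  let ?K = "quadratic_algebra c"
  interpret K: cring ?K by (rule quadratic_algebra_cring)
  obtain \<psi> where \<psi>: "\<psi> \<in> ring_hom ?K (rat_adjoin_sqrt t)"
    and bij: "bij_betw \<psi> (carrier ?K) (carrier (rat_adjoin_sqrt t))"
    using assms unfolding is_ring_iso_def ring_iso_def by blast
  have "s \<in> carrier (rat_adjoin_sqrt t)"
    by (simp add: rat_adjoin_sqrt_def s_def generate_field.incl)
  then obtain x where x: "x \<in> carrier ?K" "\<psi> x = s"
    using bij_betw_imp_surj_on[OF bij] by (metis imageE)
  have mult: "\<psi> (x \<otimes>\<^bsub>?K\<^esub> x) = of_rat t"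
    using ring_hom_mult[OF \<psi> x(1) x(1)] x(2) power2_csqrt[of "of_rat t"]
    by (simp add: rat_adjoin_sqrt_def s_def power2_eq_square)
  have const: "residue_class c [: r :] \<in> carrier ?K" for r
    by (simp add: carrier_quadratic_algebra)
  have "\<psi> (residue_class c [: r :]) = of_rat r" for r
  proof (rule additive_rat_eq_of_rat)
    show "\<psi> (residue_class c [: r + s :]) = \<psi> (residue_class c [: r :]) + \<psi> (residue_class c [: s :])"
      for r s
      using ring_hom_add[OF \<psi> const[of r] const[of s]]
      by (simp add: residue_class_add rat_adjoin_sqrt_def)
    show "\<psi> (residue_class c [: 1 :]) = 1"
      using ring_hom_one[OF \<psi>] by (simp add: residue_class_one rat_adjoin_sqrt_def flip: one_pCons)
  qed
  then have "\<psi> (x \<otimes>\<^bsub>?K\<^esub> x) = \<psi> (residue_class c [: t :])" using mult by simp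
  then have "x \<otimes>\<^bsub>?K\<^esub> x = residue_class c [: t :]"
    using inj_onD[OF bij_betw_imp_inj_on[OF bij]] x(1) const[of t] K.m_closed by blast
  then show ?thesis using that x(1) by blast
qed

lemma quadratic_algebra_adjoin_sqrt_iff:
  assumes irr: "csqrt (of_rat t) \<notin> \<rat>"
  shows "quadratic_algebra c \<simeq> rat_adjoin_sqrt t \<longleftrightarrow>
    (\<exists>x\<in>carrier (quadratic_algebra c). x \<otimes>\<^bsub>quadratic_algebra c\<^esub> x = residue_class c [: t :])"
proof
  assume "quadratic_algebra c \<simeq> rat_adjoin_sqrt t"
  then obtain x where "x \<in> carrier (quadratic_algebra c)"
    "x \<otimes>\<^bsub>quadratic_algebra c\<^esub> x = residue_class c [: t :]"
    by (rule adjoin_sqrt_iso_imp_square_root)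
  then show "\<exists>x\<in>carrier (quadratic_algebra c). x \<otimes>\<^bsub>quadratic_algebra c\<^esub> x = residue_class c [: t :]"
    by blast
next
  assume "\<exists>x\<in>carrier (quadratic_algebra c). x \<otimes>\<^bsub>quadratic_algebra c\<^esub> x = residue_class c [: t :]"
  then obtain x where x: "x \<in> carrier (quadratic_algebra c)"
    "x \<otimes>\<^bsub>quadratic_algebra c\<^esub> x = residue_class c [: t :]" by blast
  obtain b where "b \<noteq> 0" "t = - (b * b * c)"
    by (rule square_root_in_quadratic_algebra[OF x csqrt_irrational_not_square[OF irr]])
  then show "quadratic_algebra c \<simeq> rat_adjoin_sqrt t"
    by (rule quadratic_algebra_iso_adjoin_sqrt[OF irr])
qed

section \<open>The Frobenius automorphism\<close>

text \<open>
  The map \<open>x \<mapsto> x\<^sup>q\<close> is additive because \<open>q\<close> is a power of the characteristic; the locale records this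
  property of the cardinality once for the type of the ground field.
\<close>

locale prime_power_field =
  fixes ty :: "'k::{field,finite} itself"
  assumes card_prime_power: "\<exists>n. CARD('k) = CHAR('k) ^ n"
begin

lemma CHAR_prime_field: "Factorial_Ring.prime CHAR('k)"
  using prime_CHAR_semidom[where ?'a = 'k] finite_imp_CHAR_pos[where ?'a = 'k] by simp

lemma arith_frob_add: "arith_frob (x + y :: 'k alg_closure) = arith_frob x + arith_frob y"
  using card_prime_power CHAR_prime_field
  by (auto simp: arith_frob_def freshmans_dream')

end

lemma arith_frob_0 [simp]: "arith_frob (0 :: 'k::{field,finite} alg_closure) = 0"
  by (simp add: arith_frob_def)

lemma arith_frob_1 [simp]: "arith_frob (1 :: 'k::{field,finite} alg_closure) = 1"
  by (simp add: arith_frob_def)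

lemma arith_frob_eq_0_iff [simp]: "arith_frob (x :: 'k::{field,finite} alg_closure) = 0 \<longleftrightarrow> x = 0"
  by (simp add: arith_frob_def)

lemma arith_frob_mult: "arith_frob (x * y :: 'k::{field,finite} alg_closure) = arith_frob x * arith_frob y"
  by (simp add: arith_frob_def power_mult_distrib)

lemma arith_frob_divide: "arith_frob (x / y :: 'k::{field,finite} alg_closure) = arith_frob x / arith_frob y"
  by (simp add: arith_frob_def power_divide)

lemma arith_frob_power: "arith_frob (x ^ m :: 'k::{field,finite} alg_closure) = arith_frob x ^ m"
  by (simp add: arith_frob_def power_commutes flip: power_mult) (simp add: mult.commute)

text \<open>Multiplication by a nonzero \<open>x\<close> permutes the nonzero elements, whose product is nonzero.\<close>

lemma power_card_field: "(x :: 'k::{field,finite}) ^ CARD('k) = x"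
proof (cases "x = 0")
  case False
  let ?U = "UNIV - {0 :: 'k}"
  have "(\<Prod>y\<in>?U. x * y) = \<Prod>?U"
    by (rule prod.reindex_bij_witness[of _ "\<lambda>y. y / x" "\<lambda>y. x * y"]) (use False in auto)
  then have "x ^ card ?U * \<Prod>?U = \<Prod>?U"
    by (simp add: prod.distrib)
  moreover have "\<Prod>?U \<noteq> 0" by simp
  ultimately have "x ^ card ?U = 1" by simp
  moreover have "CARD('k) = Suc (card ?U)"
    using card_Suc_Diff1[of "UNIV :: 'k set" 0] by simp
  ultimately show ?thesis by (simp only: power_Suc mult_1_right)
qed (simp add: zero_power)

lemma arith_frob_to_ac: "arith_frob (to_ac (c :: 'k::{field,finite})) = to_ac c"
  by (simp add: arith_frob_def power_card_field flip: to_ac_power)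

lemma arith_frob_numeral: "arith_frob (numeral w :: 'k::{field,finite} alg_closure) = numeral w"
  using arith_frob_to_ac[of "numeral w :: 'k"] by simp

context prime_power_field
begin

lemma arith_frob_minus: "arith_frob (- x :: 'k alg_closure) = - arith_frob x"
  using arith_frob_add[of x "- x"] by (simp add: eq_neg_iff_add_eq_0 add.commute)

lemma arith_frob_diff: "arith_frob (x - y :: 'k alg_closure) = arith_frob x - arith_frob y"
  using arith_frob_add[of x "- y"] by (simp add: arith_frob_minus)

lemma arith_frob_sum: "arith_frob (\<Sum>i\<in>A. f i :: 'k alg_closure) = (\<Sum>i\<in>A. arith_frob (f i))"
  by (induction A rule: infinite_finite_induct) (simp_all add: arith_frob_add)

lemma arith_frob_eq_iff [simp]: "arith_frob (x :: 'k alg_closure) = arith_frob y \<longleftrightarrow> x = y"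
  using arith_frob_eq_0_iff[of "x - y"] by (simp add: arith_frob_diff)

lemmas arith_frob_simps = arith_frob_add arith_frob_minus arith_frob_diff arith_frob_mult
  arith_frob_divide arith_frob_power arith_frob_to_ac arith_frob_numeral

end

section \<open>The group law on a Weierstrass curve\<close>

text \<open>
  The abscissae of the intersection of the curve with a line are the roots of a monic cubic.  The
  third root is read off the coefficient of \<open>x\<^sup>2\<close>, and the hypothesis on \<open>x1\<close> and \<open>x2\<close>, the divided
  difference of the cubic, covers two distinct roots as well as a double root.
\<close>

lemma cubic_third_root:
  fixes A B D x1 x2 x3 :: "'a::field"
  assumes "x1^3 + A * x1^2 + B * x1 + D = 0"
    and "x1^2 + x1 * x2 + x2^2 + A * (x1 + x2) + B = 0"
    and "x3 = - A - x1 - x2"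
  shows "x3^3 + A * x3^2 + B * x3 + D = 0"
proof -
  have "x3^3 + A * x3^2 + B * x3 + D = (x1^3 + A * x1^2 + B * x1 + D)
      + (x3 - x1) * ((x1^2 + x1 * x2 + x2^2 + A * (x1 + x2) + B) + (x3 - x2) * (x1 + x2 + x3 + A))"
    by (simp add: algebra_simps power2_eq_square power3_eq_cube)
  then show ?thesis using assms by simp
qed

text \<open>
  Substituting \<open>y = l x + n\<close> into the equation gives the cubic.  For a chord its divided difference
  vanishes because \<open>x1 \<noteq> x2\<close> are both roots; for \<open>x1 = x2\<close> the points coincide, and the vanishing is the
  definition of the tangent slope.
\<close>

lemma chord_tangent_point_on_curve:
  fixes c1 c2 c3 c4 c6 l n :: "'a::field"
  assumes P1: "y1^2 + c1 * x1 * y1 + c3 * y1 = x1^3 + c2 * x1^2 + c4 * x1 + c6"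
    and P2: "y2^2 + c1 * x2 * y2 + c3 * y2 = x2^3 + c2 * x2^2 + c4 * x2 + c6"
    and nopp: "\<not> (x1 = x2 \<and> y1 + y2 + c1 * x2 + c3 = 0)"
    and l: "l = (if x1 = x2
                    then (3 * x1^2 + 2 * c2 * x1 + c4 - c1 * y1) / (2 * y1 + c1 * x1 + c3)
                    else (y2 - y1) / (x2 - x1))"
    and n: "n = y1 - l * x1"
    and x3: "x3 = l^2 + c1 * l - c2 - x1 - x2"
    and y3: "y3 = - (l + c1) * x3 - n - c3"
  shows "y3^2 + c1 * x3 * y3 + c3 * y3 = x3^3 + c2 * x3^2 + c4 * x3 + c6"
proof -
  define A where "A = c2 - l^2 - c1 * l"
  define B where "B = c4 - 2 * l * n - c1 * n - c3 * l"
  define D where "D = c6 - n^2 - c3 * n"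
  have on_line: "x^3 + A * x^2 + B * x + D
      = (x^3 + c2 * x^2 + c4 * x + c6) - (y^2 + c1 * x * y + c3 * y)" if "y = l * x + n" for x y
    unfolding that A_def B_def D_def by (simp add: algebra_simps power2_eq_square power3_eq_cube)
  have y1: "y1 = l * x1 + n" using n by simp
  have root1: "x1^3 + A * x1^2 + B * x1 + D = 0"
    using on_line[OF y1] P1 by simp
  have "x1^2 + x1 * x2 + x2^2 + A * (x1 + x2) + B = 0"
  proof (cases "x1 = x2")
    case True
    have "(y1 - y2) * (y1 + y2 + c1 * x2 + c3)
        = (y1^2 + c1 * x1 * y1 + c3 * y1) - (y2^2 + c1 * x2 * y2 + c3 * y2)"
      unfolding True by (simp add: algebra_simps power2_eq_square)
    also have "\<dots> = 0" using P1 P2 True by simp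
    finally have "y2 = y1" using nopp True by simp
    then have "2 * y1 + c1 * x1 + c3 = y1 + y2 + c1 * x2 + c3"
      by (simp only: mult_2 True)
    then have "2 * y1 + c1 * x1 + c3 \<noteq> 0"
      using nopp True by argo
    then have tangent: "l * (2 * y1 + c1 * x1 + c3) = 3 * x1^2 + 2 * c2 * x1 + c4 - c1 * y1"
      using l True by simp
    have "x1^2 + x1 * x2 + x2^2 + A * (x1 + x2) + B
        = (3 * x1^2 + 2 * c2 * x1 + c4 - c1 * y1) - l * (2 * y1 + c1 * x1 + c3)"
      unfolding True[symmetric] A_def B_def y1
      by (simp add: algebra_simps power2_eq_square)
    then show ?thesis using tangent by simp
  next
    case False
    then have "l * (x2 - x1) = y2 - y1" using l by simp
    then have "y2 = y1 + l * (x2 - x1)" by simp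
    then have "y2 = l * x2 + n" unfolding n by (simp add: algebra_simps)
    from on_line[OF this] have root2: "x2^3 + A * x2^2 + B * x2 + D = 0"
      using P2 by simp
    have "(x1 - x2) * (x1^2 + x1 * x2 + x2^2 + A * (x1 + x2) + B)
        = (x1^3 + A * x1^2 + B * x1 + D) - (x2^3 + A * x2^2 + B * x2 + D)"
      by (simp add: algebra_simps power2_eq_square power3_eq_cube)
    then show ?thesis using root1 root2 False by simp
  qed
  moreover have "x3 = - A - x1 - x2" by (simp add: x3 A_def)
  ultimately have "x3^3 + A * x3^2 + B * x3 + D = 0"
    using cubic_third_root[OF root1] by blast
  moreover have "y3^2 + c1 * x3 * y3 + c3 * y3
      = (l * x3 + n)^2 + c1 * x3 * (l * x3 + n) + c3 * (l * x3 + n)"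
    unfolding y3 by (simp add: algebra_simps power2_eq_square)
  ultimately show ?thesis
    using on_line[OF refl, of x3] by simp
qed

lemma Affine_in_points_iff:
  "Affine x y \<in> points E \<longleftrightarrow>
     y^2 + to_ac (a1 E) * x * y + to_ac (a3 E) * y
       = x^3 + to_ac (a2 E) * x^2 + to_ac (a4 E) * x + to_ac (a6 E)"
  by (simp add: points_def)

lemma Origin_in_points [simp]: "Origin \<in> points E"
  by (simp add: points_def)

lemma point_add_closed:
  assumes P: "P \<in> points E" and Q: "Q \<in> points E"
  shows "point_add E P Q \<in> points E"
proof (cases P)
  case P1: (Affine x1 y1)
  show ?thesis
  proof (cases Q)
    case Q1: (Affine x2 y2)
    show ?thesis
    proof (cases "x1 = x2 \<and> y1 + y2 + to_ac (a1 E) * x2 + to_ac (a3 E) = 0")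
      case False
      show ?thesis
        using P Q chord_tangent_point_on_curve[OF _ _ False refl refl refl refl]
        unfolding P1 Q1 by (simp only: point_add.simps Let_def False if_False Affine_in_points_iff)
    qed (simp add: P1 Q1)
  qed (use P P1 in simp)
qed (use Q in simp)

section \<open>The Frobenius endomorphism\<close>

context prime_power_field
begin

lemma frob_in_points:
  assumes "P \<in> points (E :: 'k weierstrass)"
  shows "map_point arith_frob P \<in> points E"
proof (cases P)
  case (Affine x y)
  have "y^2 + to_ac (a1 E) * x * y + to_ac (a3 E) * y
       = x^3 + to_ac (a2 E) * x^2 + to_ac (a4 E) * x + to_ac (a6 E)"
    using assms by (simp add: Affine Affine_in_points_iff)
  from arg_cong[OF this, of arith_frob] show ?thesis
    by (simp add: Affine Affine_in_points_iff arith_frob_simps)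
qed simp

lemma frob_point_add:
  "map_point arith_frob (point_add (E :: 'k weierstrass) P Q)
     = point_add E (map_point arith_frob P) (map_point arith_frob Q)"
proof (cases P)
  case P1: (Affine x1 y1)
  show ?thesis
  proof (cases Q)
    case Q1: (Affine x2 y2)
    have "arith_frob y1 + arith_frob y2 + to_ac (a1 E) * arith_frob x2 + to_ac (a3 E)
        = arith_frob (y1 + y2 + to_ac (a1 E) * x2 + to_ac (a3 E))"
      by (simp add: arith_frob_simps)
    then have opposite: "arith_frob y1 + arith_frob y2 + to_ac (a1 E) * arith_frob x2 + to_ac (a3 E) = 0
        \<longleftrightarrow> y1 + y2 + to_ac (a1 E) * x2 + to_ac (a3 E) = 0"
      by simp
    show ?thesis
      by (simp add: P1 Q1 Let_def opposite arith_frob_simps)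
  qed (simp add: P1)
qed simp

lemma hcoords_frob:
  "hcoords (map_point arith_frob (P :: 'k alg_closure point))
     = (case hcoords P of (x, y, z) \<Rightarrow> (arith_frob x, arith_frob y, arith_frob z))"
  by (cases P) simp_all

lemma eval_form_frob:
  "eval_form d (c :: nat \<Rightarrow> nat \<Rightarrow> 'k) (arith_frob x, arith_frob y, arith_frob z)
     = arith_frob (eval_form d c (x, y, z))"
  by (simp add: arith_frob_sum arith_frob_simps)

end

lemma eval_form_single:
  assumes "i0 + j0 \<le> d"
  shows "eval_form d (\<lambda>i j. if i = i0 \<and> j = j0 then 1 else 0) (x, y, z)
     = x ^ i0 * y ^ j0 * z ^ (d - i0 - j0)"
proof -
  let ?M = "x ^ i0 * y ^ j0 * z ^ (d - i0 - j0)"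
  have monomial: "to_ac (if i = i0 \<and> j = j0 then 1 else 0) * x ^ i * y ^ j * z ^ (d - i - j)
      = (if j = j0 then if i = i0 then ?M else 0 else 0)" for i j
    by auto
  have "(\<Sum>j\<le>d - i. if j = j0 then if i = i0 then ?M else 0 else 0) = (if i = i0 then ?M else 0)" for i
    using assms by (cases "i = i0") (simp_all add: sum.delta)
  then show ?thesis
    unfolding eval_form.simps monomial using assms by (simp add: sum.delta)
qed

lemma frobenius_endo_apply:
  assumes "P \<in> points (E :: 'k::{field,finite} weierstrass)"
  shows "frobenius_endo E P = map_point arith_frob P"
  using assms by (simp add: frobenius_endo_def arith_frob_def[abs_def])

context prime_power_field
begin

text \<open>
  In homogeneous coordinates the Frobenius map is given everywhere by the three forms \<open>X\<^sup>q\<close>, \<open>Y\<^sup>q\<close>,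
  \<open>Z\<^sup>q\<close>, with scalar \<open>1\<close>.
\<close>

lemma frobenius_endo_regular: "regular_map (E :: 'k weierstrass) (frobenius_endo E)"
  unfolding regular_map_def
proof
  fix P assume P: "P \<in> points E"
  let ?q = "CARD('k)"
  let ?F = "\<lambda>i j. if i = ?q \<and> j = 0 then 1 else (0::'k)"
  let ?G = "\<lambda>i j. if i = 0 \<and> j = ?q then 1 else (0::'k)"
  let ?H = "\<lambda>i j. if i = 0 \<and> j = 0 then 1 else (0::'k)"
  have FGH: "eval_form ?q ?F v = arith_frob (fst v)" "eval_form ?q ?G v = arith_frob (fst (snd v))"
    "eval_form ?q ?H v = arith_frob (snd (snd v))" for v
    using eval_form_single[of ?q 0 ?q "fst v" "fst (snd v)" "snd (snd v)"]
      eval_form_single[of 0 ?q ?q "fst v" "fst (snd v)" "snd (snd v)"]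
      eval_form_single[of 0 0 ?q "fst v" "fst (snd v)" "snd (snd v)"]
    by (simp_all add: arith_frob_def)
  have nz: "(eval_form ?q ?F (hcoords P), eval_form ?q ?G (hcoords P), eval_form ?q ?H (hcoords P)) \<noteq> (0, 0, 0)"
    unfolding FGH by (cases P) simp_all
  have scale: "\<exists>s. case hcoords (frobenius_endo E Q) of (x, y, z) \<Rightarrow>
           eval_form ?q ?F (hcoords Q) = s * x \<and>
           eval_form ?q ?G (hcoords Q) = s * y \<and>
           eval_form ?q ?H (hcoords Q) = s * z" if "Q \<in> points E" for Q
    unfolding FGH frobenius_endo_apply[OF that] hcoords_frob
    by (rule exI[of _ 1]) (simp add: split_beta)
  show "\<exists>d F G H.
        (eval_form d F (hcoords P), eval_form d G (hcoords P), eval_form d H (hcoords P)) \<noteq> (0, 0, 0) \<and>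
        (\<forall>Q\<in>points E. \<exists>s. case hcoords (frobenius_endo E Q) of (x, y, z) \<Rightarrow>
           eval_form d F (hcoords Q) = s * x \<and>
           eval_form d G (hcoords Q) = s * y \<and>
           eval_form d H (hcoords Q) = s * z)"
    using nz scale by blast
qed

lemma frobenius_endo_endomorphism: "frobenius_endo (E :: 'k weierstrass) \<in> endomorphisms E"
  unfolding endomorphisms_def
proof (intro CollectI conjI ballI)
  show "frobenius_endo E \<in> points E \<rightarrow>\<^sub>E points E"
    using frob_in_points frobenius_endo_apply
    by (auto simp: PiE_def extensional_def frobenius_endo_def arith_frob_def[abs_def])
  show "frobenius_endo E (point_add E P Q) = point_add E (frobenius_endo E P) (frobenius_endo E Q)"
    if "P \<in> points E" "Q \<in> points E" for P Q
    using that by (simp add: frobenius_endo_apply point_add_closed frob_point_add)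
qed (rule frobenius_endo_regular)

end

text \<open>
  The coordinates are normalised by \<open>z = 1\<close> at affine points, and by \<open>y = 1\<close> at the origin, where
  \<open>z = 0\<close>; a common factor of proportionality therefore has to be trivial.
\<close>

lemma hcoords_proportional_imp_eq:
  fixes P Q :: "'a::field point"
  assumes "hcoords P = (x, y, z)" "hcoords Q = (x', y', z')"
    and "(s * x, s * y, s * z) = (s' * x', s' * y', s' * z')" "(s * x, s * y, s * z) \<noteq> (0, 0, 0)"
  shows "P = Q"
  using assms by (cases P; cases Q) auto

context prime_power_field
begin

text \<open>
  The forms that describe \<open>f\<close> near the Frobenius image of \<open>P\<close> have coefficients in the ground field,
  so their values there are the \<open>q\<close>-th powers of their values at \<open>P\<close>.  Hence they do not vanish at
  \<open>P\<close> either, and the two points \<open>f (Frob P)\<close> and \<open>Frob (f P)\<close> have proportional coordinates.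
\<close>

lemma regular_map_frob:
  assumes f: "regular_map (E :: 'k weierstrass) f" and P: "P \<in> points E"
  shows "f (map_point arith_frob P) = map_point arith_frob (f P)"
proof -
  let ?P' = "map_point arith_frob P"
  have P': "?P' \<in> points E" using P by (rule frob_in_points)
  obtain d F G H where nz: "(eval_form d F (hcoords ?P'), eval_form d G (hcoords ?P'),
      eval_form d H (hcoords ?P')) \<noteq> (0, 0, 0)"
    and scale: "\<And>Q. Q \<in> points E \<Longrightarrow> \<exists>s. case hcoords (f Q) of (x, y, z) \<Rightarrow>
           eval_form d F (hcoords Q) = s * x \<and>
           eval_form d G (hcoords Q) = s * y \<and>
           eval_form d H (hcoords Q) = s * z"
    using f P' unfolding regular_map_def by metis
  obtain px py pz where hP: "hcoords P = (px, py, pz)" by (cases "hcoords P")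
  obtain x y z where h1: "hcoords (f ?P') = (x, y, z)" by (cases "hcoords (f ?P')")
  obtain x' y' z' where h2: "hcoords (f P) = (x', y', z')" by (cases "hcoords (f P)")
  obtain s where s: "eval_form d F (hcoords ?P') = s * x" "eval_form d G (hcoords ?P') = s * y"
      "eval_form d H (hcoords ?P') = s * z"
    using scale[OF P'] h1 by auto
  obtain s' where s': "eval_form d F (hcoords P) = s' * x'" "eval_form d G (hcoords P) = s' * y'"
      "eval_form d H (hcoords P) = s' * z'"
    using scale[OF P] h2 by auto
  have frob: "eval_form d c (hcoords ?P') = arith_frob (eval_form d c (hcoords P))" for c
    by (simp add: hcoords_frob hP eval_form_frob del: eval_form.simps)
  show ?thesis
  proof (rule hcoords_proportional_imp_eq[OF h1])
    show "hcoords (map_point arith_frob (f P)) = (arith_frob x', arith_frob y', arith_frob z')"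
      by (simp add: hcoords_frob h2)
    show "(s * x, s * y, s * z)
        = (arith_frob s' * arith_frob x', arith_frob s' * arith_frob y', arith_frob s' * arith_frob z')"
      by (simp add: s[symmetric] frob s' flip: arith_frob_mult)
    show "(s * x, s * y, s * z) \<noteq> (0, 0, 0)"
      using nz unfolding s .
  qed
qed

lemma frobenius_endo_commutes:
  assumes f: "f \<in> endomorphisms (E :: 'k weierstrass)"
  shows "compose (points E) (frobenius_endo E) f = compose (points E) f (frobenius_endo E)"
proof (rule extensionalityI[of _ "points E"])
  fix P assume P: "P \<in> points E"
  have "f P \<in> points E" using f P by (auto simp: endomorphisms_def)
  then show "compose (points E) (frobenius_endo E) f P = compose (points E) f (frobenius_endo E) P"
    using f P by (simp add: compose_eq frobenius_endo_apply endomorphisms_def regular_map_frob[of E])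
qed auto

text \<open>
  Every element of the rational endomorphism algebra has a positive integer multiple that comes from
  an endomorphism, so commuting with endomorphisms is enough for being central.
\<close>

lemma frobenius_central:
  assumes B: "is_rational_tensor (End_ring (E :: 'k weierstrass)) B h"
  shows "h (frobenius_endo E) \<in> center B"
proof -
  interpret rational_algebra B
    using B unfolding is_rational_tensor_def rat_algebra_def
    by (simp add: rational_algebra_def rational_algebra_axioms_def)
  let ?R = "End_ring E"
  have h: "h \<in> ring_hom ?R B" using B by (simp add: is_rational_tensor_def)
  have \<tau>: "frobenius_endo E \<in> carrier ?R"
    by (simp add: End_ring_def frobenius_endo_endomorphism)
  have \<tau>B: "h (frobenius_endo E) \<in> carrier B" using ring_hom_closed[OF h \<tau>] .
  show ?thesis
    unfolding center_def
  proof (intro CollectI conjI ballI)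
    fix b assume b: "b \<in> carrier B"
    obtain f n where f: "f \<in> carrier ?R" and n: "(n::nat) > 0" and nb: "[n] \<cdot>\<^bsub>B\<^esub> b = h f"
      using B b unfolding is_rational_tensor_def by blast
    have "h (frobenius_endo E) \<otimes>\<^bsub>B\<^esub> h f = h f \<otimes>\<^bsub>B\<^esub> h (frobenius_endo E)"
      using ring_hom_mult[OF h \<tau> f] ring_hom_mult[OF h f \<tau>] f frobenius_endo_commutes[of f E]
      by (simp add: End_ring_def)
    then have "[n] \<cdot>\<^bsub>B\<^esub> (h (frobenius_endo E) \<otimes>\<^bsub>B\<^esub> b) = [n] \<cdot>\<^bsub>B\<^esub> (b \<otimes>\<^bsub>B\<^esub> h (frobenius_endo E))"
      unfolding nb[symmetric] using b \<tau>B by (simp add: add_pow_ldistr add_pow_rdistr)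
    then have "([n] \<cdot>\<^bsub>B\<^esub> \<one>\<^bsub>B\<^esub>) \<otimes>\<^bsub>B\<^esub> (h (frobenius_endo E) \<otimes>\<^bsub>B\<^esub> b)
        = ([n] \<cdot>\<^bsub>B\<^esub> \<one>\<^bsub>B\<^esub>) \<otimes>\<^bsub>B\<^esub> (b \<otimes>\<^bsub>B\<^esub> h (frobenius_endo E))"
      using b \<tau>B by (simp add: add_pow_ldistr)
    then show "h (frobenius_endo E) \<otimes>\<^bsub>B\<^esub> b = b \<otimes>\<^bsub>B\<^esub> h (frobenius_endo E)"
      using Units_l_cancel[OF nat_Units[OF n]] b \<tau>B by simp
  qed (rule \<tau>B)
qed

end

section \<open>The Weil group\<close>

text \<open>
  An infinite cyclic group is free on its generator.  The exponent of an element is well defined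
  because the powers of the generator are distinct.
\<close>

lemma (in group) infinite_cyclic_hom_exists:
  assumes g: "g \<in> carrier G" and gen: "carrier G = range (\<lambda>k::int. g [^] k)"
    and inj: "inj (\<lambda>k::int. g [^] k)" and H: "group H" and x: "x \<in> carrier H"
  obtains f where "f \<in> hom G H" "f g = x"
proof -
  interpret H: group H by (rule H)
  define f where "f w = x [^]\<^bsub>H\<^esub> (inv_into UNIV (\<lambda>k::int. g [^] k) w)" for w
  have f: "f (g [^] k) = x [^]\<^bsub>H\<^esub> k" for k :: int
    unfolding f_def by (simp only: inv_f_f[OF inj])
  have "f \<in> hom G H"
  proof (rule homI)
    fix v w assume "v \<in> carrier G" "w \<in> carrier G"
    then obtain j k :: int where "v = g [^] j" "w = g [^] k" using gen by auto
    then show "f (v \<otimes> w) = f v \<otimes>\<^bsub>H\<^esub> f w"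
      using g x by (simp add: f H.int_pow_mult flip: int_pow_mult)
  next
    fix w assume "w \<in> carrier G"
    then obtain k :: int where "w = g [^] k" using gen by auto
    then show "f w \<in> carrier H" using x by (simp add: f)
  qed
  moreover have "f g = x" using f[of 1] g x by simp
  ultimately show ?thesis using that by blast
qed

lemma (in group) cyclic_hom_eq:
  assumes g: "g \<in> carrier G" and gen: "carrier G = range (\<lambda>k::int. g [^] k)" and H: "group H"
    and f: "f \<in> hom G H" and f': "f' \<in> hom G H" and eq: "f g = f' g" and w: "w \<in> carrier G"
  shows "f w = f' w"
proof -
  obtain k :: int where k: "w = g [^] k" using w gen by auto
  show ?thesis
    unfolding k using hom_int_pow[OF f g group_axioms H, of k] hom_int_pow[OF f' g group_axioms H, of k] eq
    by simp
qed

context prime_power_field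
begin

abbreviation bijections :: "('k alg_closure \<Rightarrow> 'k alg_closure) monoid" where
  "bijections \<equiv> BijGroup UNIV"

lemma arith_frob_bijection: "arith_frob \<in> carrier bijections"
proof -
  have "\<exists>x. arith_frob x = y" for y :: "'k alg_closure"
    unfolding arith_frob_def by (rule nth_root_exists) simp
  then have "surj (arith_frob :: 'k alg_closure \<Rightarrow> _)"
    by (metis surjI)
  then show ?thesis
    by (auto simp: BijGroup_def Bij_def bij_betw_def inj_on_def)
qed

lemma bijections_mult:
  assumes "f \<in> carrier bijections" "g \<in> carrier bijections"
  shows "(f \<otimes>\<^bsub>bijections\<^esub> g) x = f (g x)"
  using assms by (simp add: BijGroup_def compose_def)

interpretation bijections: group bijections
  by (rule group_BijGroup)

lemma arith_frob_pow_nat: "(arith_frob [^]\<^bsub>bijections\<^esub> (m::nat)) x = x ^ (CARD('k) ^ m)"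
proof (induction m arbitrary: x)
  case 0
  show ?case by (simp add: BijGroup_def)
next
  case (Suc m)
  have carrier: "arith_frob [^]\<^bsub>bijections\<^esub> m \<in> carrier bijections"
    using arith_frob_bijection by (rule bijections.nat_pow_closed)
  have "(arith_frob [^]\<^bsub>bijections\<^esub> Suc m) x = (arith_frob [^]\<^bsub>bijections\<^esub> m) (arith_frob x)"
    unfolding bijections.nat_pow_Suc by (rule bijections_mult[OF carrier arith_frob_bijection])
  also have "\<dots> = arith_frob x ^ (CARD('k) ^ m)"
    by (rule Suc.IH)
  also have "\<dots> = x ^ (CARD('k) ^ Suc m)"
    by (simp add: arith_frob_def flip: power_mult)
  finally show ?case .
qed

text \<open>
  If a power of Frobenius were trivial, every \<open>x\<close> would satisfy \<open>x\<^sup>N = x\<close> for a fixed \<open>N > 1\<close>; but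
  \<open>X\<^sup>N - X - 1\<close> has a root.
\<close>

lemma arith_frob_infinite_order:
  assumes "arith_frob [^]\<^bsub>bijections\<^esub> (k::int) = \<one>\<^bsub>bijections\<^esub>"
  shows "k = 0"
proof (rule ccontr)
  assume "k \<noteq> 0"
  define m where "m = nat \<bar>k\<bar>"
  have m: "m > 0" using \<open>k \<noteq> 0\<close> by (simp add: m_def)
  have "arith_frob [^]\<^bsub>bijections\<^esub> int m = \<one>\<^bsub>bijections\<^esub>"
    using assms bijections.int_pow_neg[OF arith_frob_bijection, of k]
    by (cases "k \<ge> 0") (simp_all add: m_def)
  then have triv: "x ^ (CARD('k) ^ m) = x" for x :: "'k alg_closure"
    using arith_frob_pow_nat[of m x] by (simp add: int_pow_int BijGroup_def)
  define N where "N = CARD('k) ^ m"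
  have "CARD('k) > 1"
  proof -
    have "card {0, 1 :: 'k} \<le> CARD('k)" by (rule card_mono) auto
    then show ?thesis by simp
  qed
  then have N: "N > 1" using m unfolding N_def by (simp only: one_less_power)
  let ?f = "Polynomial.monom 1 N - [: 1, 1 :] :: 'k alg_closure poly"
  have "Polynomial.coeff ?f N = 1"
    using N by (simp add: coeff_pCons split: nat.split)
  then have "Polynomial.degree ?f > 0"
    using le_degree[of ?f N] N by simp
  then obtain x where "poly ?f x = 0"
    using alg_closed_imp_poly_has_root by blast
  then show False using triv[of x] by (simp add: poly_monom N_def)
qed

lemma weil_group_group: "group (weil_group :: ('k alg_closure \<Rightarrow> _) monoid)"
  and geom_frob_in_weil_group: "(geom_frob :: 'k alg_closure \<Rightarrow> _) \<in> carrier weil_group"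
  and carrier_weil_group: "carrier (weil_group :: ('k alg_closure \<Rightarrow> _) monoid)
        = range (\<lambda>k::int. geom_frob [^]\<^bsub>weil_group\<^esub> k)"
  and geom_frob_pow_inj: "inj (\<lambda>k::int. (geom_frob :: 'k alg_closure \<Rightarrow> _) [^]\<^bsub>weil_group\<^esub> k)"
proof -
  let ?\<phi> = "arith_frob :: 'k alg_closure \<Rightarrow> _"
  have sub: "subgroup (generate bijections {?\<phi>}) bijections"
    using arith_frob_bijection by (intro bijections.generate_is_subgroup) simp
  show W: "group (weil_group :: ('k alg_closure \<Rightarrow> _) monoid)"
    unfolding weil_group_def using bijections.subgroup_imp_group[OF sub] .
  interpret W: group "weil_group :: ('k alg_closure \<Rightarrow> _) monoid" by (rule W)
  have \<phi>: "?\<phi> \<in> carrier weil_group"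
    by (simp add: weil_group_def generate.incl)
  then show geom: "(geom_frob :: 'k alg_closure \<Rightarrow> _) \<in> carrier weil_group"
    by (simp add: geom_frob_def)
  have pow: "?\<phi> [^]\<^bsub>weil_group\<^esub> k = ?\<phi> [^]\<^bsub>bijections\<^esub> k" for k :: int
    unfolding weil_group_def using bijections.int_pow_consistent[OF sub generate.incl] by simp
  have geom_pow: "geom_frob [^]\<^bsub>weil_group\<^esub> k = ?\<phi> [^]\<^bsub>weil_group\<^esub> (- k)" for k :: int
    unfolding geom_frob_def using W.int_pow_inv[OF \<phi>, of k] W.int_pow_neg[OF \<phi>, of k] by simp
  have "carrier (weil_group :: ('k alg_closure \<Rightarrow> _) monoid) = range (\<lambda>k::int. ?\<phi> [^]\<^bsub>weil_group\<^esub> k)"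
    unfolding pow using bijections.generate_pow[OF arith_frob_bijection]
    by (auto simp: weil_group_def)
  also have "\<dots> = range (\<lambda>k::int. geom_frob [^]\<^bsub>weil_group\<^esub> k)"
  proof (intro equalityI subsetI)
    fix w assume "w \<in> range (\<lambda>k::int. ?\<phi> [^]\<^bsub>weil_group\<^esub> k)"
    then obtain k :: int where "w = ?\<phi> [^]\<^bsub>weil_group\<^esub> k" by auto
    then have "w = geom_frob [^]\<^bsub>weil_group\<^esub> (- k)" by (simp add: geom_pow)
    then show "w \<in> range (\<lambda>k::int. geom_frob [^]\<^bsub>weil_group\<^esub> k)" by blast
  next
    fix w :: "'k alg_closure \<Rightarrow> 'k alg_closure"
    assume "w \<in> range (\<lambda>k::int. geom_frob [^]\<^bsub>weil_group\<^esub> k)"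
    then obtain k :: int where "w = ?\<phi> [^]\<^bsub>weil_group\<^esub> (- k)" by (auto simp: geom_pow)
    then show "w \<in> range (\<lambda>k::int. ?\<phi> [^]\<^bsub>weil_group\<^esub> k)" by blast
  qed
  finally show "carrier (weil_group :: ('k alg_closure \<Rightarrow> _) monoid)
        = range (\<lambda>k::int. geom_frob [^]\<^bsub>weil_group\<^esub> k)" .
  show "inj (\<lambda>k::int. (geom_frob :: 'k alg_closure \<Rightarrow> _) [^]\<^bsub>weil_group\<^esub> k)"
  proof (rule injI)
    fix j k :: int
    assume "(geom_frob :: 'k alg_closure \<Rightarrow> _) [^]\<^bsub>weil_group\<^esub> j = geom_frob [^]\<^bsub>weil_group\<^esub> k"
    then have "?\<phi> [^]\<^bsub>bijections\<^esub> (- j) = ?\<phi> [^]\<^bsub>bijections\<^esub> (- k)"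
      by (simp only: geom_pow pow)
    then have "?\<phi> [^]\<^bsub>bijections\<^esub> (- j + k) = \<one>\<^bsub>bijections\<^esub>"
      using bijections.int_pow_mult[OF arith_frob_bijection, of "- j" k]
        bijections.int_pow_mult[OF arith_frob_bijection, of "- k" k] by simp
    then show "j = k" using arith_frob_infinite_order by fastforce
  qed
qed

end

section \<open>Lifts of the similitude representation\<close>

text \<open>
  As \<open>u\<^sup>2 = - Nrd(u)\<close> and \<open>1\<close>, \<open>u\<close> are independent, the kernel of \<open>f \<mapsto> f(u)\<close> is exactly the ideal that
  defines the even Clifford algebra.
\<close>

lemma (in quaternion_basis) clifford_embedding_iso:
  assumes u: "u \<in> carrier B" "u \<noteq> \<zero>" and conj: "quat_conj B u = \<ominus> u"
  shows "clifford_embedding B u \<in> ring_iso (even_clifford B u) (B\<lparr>carrier := range (eval_at B u)\<rparr>)"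
    and "clifford_embedding B u (residue_class (nrd B u) [: r :]) = rat_scalar B r"
proof -
  have root: "eval_at B u [: nrd B u, 0, 1 :] = \<zero>"
    using u anti_selfconjugate_square[OF u(1) conj]
    by (simp add: eval_at_pCons flip: rat_scalar_add)
  have indep: "c = 0 \<and> d = 0" if "eval_at B u [: c, d :] = \<zero>" for c d
    using anti_selfconjugate_independent[OF u conj, of c d] that u by (simp add: eval_at_pCons)
  note image = quadratic_algebra_image[OF ring_axioms eval_at_ring_hom[OF u(1)] root indep]
  show "clifford_embedding B u \<in> ring_iso (even_clifford B u) (B\<lparr>carrier := range (eval_at B u)\<rparr>)"
    using image(1) by (simp add: even_clifford_quadratic clifford_embedding_def[abs_def])
  show "clifford_embedding B u (residue_class (nrd B u) [: r :]) = rat_scalar B r"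
    using image(2)[of "[: r :]"] u by (simp add: clifford_embedding_def)
qed

text \<open>
  A lift is determined by its value at the geometric Frobenius, because the Weil group is free on
  this element, and any unit of the even Clifford algebra with the right square is a possible value.
  The embedding into \<open>B\<close> is injective, so the equation for this square may be read in the Clifford
  algebra; a solution is automatically a unit since \<open>t \<noteq> 0\<close>.
\<close>

lemma (in prime_power_field) spin_lift_exists_iff:
  fixes \<rho> :: "('k alg_closure \<Rightarrow> 'k alg_closure) \<Rightarrow> 'b"
  assumes quat: "quaternion_basis B a b i j"
    and u: "u \<in> carrier B" "u \<noteq> \<zero>\<^bsub>B\<^esub>" and conj: "quat_conj B u = \<ominus>\<^bsub>B\<^esub> u"
    and \<rho>: "\<rho> \<in> hom weil_group (GO_plus B \<sigma>)" and \<rho>g: "\<rho> geom_frob = rat_scalar B t"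
    and t: "t \<noteq> 0"
  shows "(\<exists>\<rho>'. spin_lift B u \<rho> \<rho>') \<longleftrightarrow>
    (\<exists>x\<in>carrier (even_clifford B u). x \<otimes>\<^bsub>even_clifford B u\<^esub> x = residue_class (nrd B u) [: t :])"
proof -
  interpret quaternion_basis B a b i j by (rule quat)
  let ?K = "even_clifford B u" and ?e = "clifford_embedding B u" and ?W = "weil_group :: ('k alg_closure \<Rightarrow> _) monoid"
  interpret K: cring ?K unfolding even_clifford_quadratic by (rule quadratic_algebra_cring)
  interpret W: group ?W by (rule weil_group_group)
  have e: "?e \<in> ring_hom ?K (B\<lparr>carrier := range (eval_at B u)\<rparr>)" and e_inj: "inj_on ?e (carrier ?K)"
    using clifford_embedding_iso(1)[OF u conj] unfolding ring_iso_def bij_betw_def by auto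
  have e_closed: "?e x \<in> carrier B" if "x \<in> carrier ?K" for x
    using ring_hom_closed[OF e that] u by auto
  have e_mult: "?e (x \<otimes>\<^bsub>?K\<^esub> y) = ?e x \<otimes>\<^bsub>B\<^esub> ?e y" if "x \<in> carrier ?K" "y \<in> carrier ?K" for x y
    using ring_hom_mult[OF e that] by simp
  have e_one: "?e \<one>\<^bsub>?K\<^esub> = \<one>\<^bsub>B\<^esub>"
    using ring_hom_one[OF e] by simp
  have scalar: "residue_class (nrd B u) [: r :] \<in> carrier ?K" for r
    by (simp add: even_clifford_quadratic carrier_quadratic_algebra)
  have cover_iff: "spin_cover B u x = rat_scalar B t \<longleftrightarrow> x \<otimes>\<^bsub>?K\<^esub> x = residue_class (nrd B u) [: t :]"
    if "x \<in> carrier ?K" for x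
    unfolding spin_cover_def clifford_embedding_iso(2)[OF u conj, of t, symmetric]
    using inj_on_eq_iff[OF e_inj] that scalar by simp
  show ?thesis
  proof
    assume "\<exists>\<rho>'. spin_lift B u \<rho> \<rho>'"
    then obtain \<rho>' where hom: "\<rho>' \<in> hom ?W (GSpin B u)"
      and lift: "\<And>w. w \<in> carrier ?W \<Longrightarrow> spin_cover B u (\<rho>' w) = \<rho> w"
      unfolding spin_lift_def by blast
    have "\<rho>' geom_frob \<in> carrier ?K"
      using hom_in_carrier[OF hom geom_frob_in_weil_group]
      by (simp add: GSpin_def units_of_def K.Units_closed)
    then show "\<exists>x\<in>carrier ?K. x \<otimes>\<^bsub>?K\<^esub> x = residue_class (nrd B u) [: t :]"
      using lift[OF geom_frob_in_weil_group] \<rho>g cover_iff by auto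
  next
    assume "\<exists>x\<in>carrier ?K. x \<otimes>\<^bsub>?K\<^esub> x = residue_class (nrd B u) [: t :]"
    then obtain x where x: "x \<in> carrier ?K" "x \<otimes>\<^bsub>?K\<^esub> x = residue_class (nrd B u) [: t :]"
      by blast
    have "residue_class (nrd B u) [: t :] \<otimes>\<^bsub>?K\<^esub> residue_class (nrd B u) [: inverse t :] = \<one>\<^bsub>?K\<^esub>"
      using t by (simp add: even_clifford_quadratic residue_class_mult residue_class_one flip: one_pCons)
    then have "residue_class (nrd B u) [: t :] \<in> Units ?K"
      using K.unit_factor[OF _ scalar[of t] scalar[of "inverse t"]] by simp
    then have xU: "x \<in> Units ?K"
      using K.unit_factor[of x x] x by simp
    then obtain \<rho>' where \<rho>': "\<rho>' \<in> hom ?W (GSpin B u)" "\<rho>' geom_frob = x"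
      using W.infinite_cyclic_hom_exists[OF geom_frob_in_weil_group carrier_weil_group geom_frob_pow_inj
          K.units_group, of x]
      by (auto simp: GSpin_def units_of_def)
    have e_Units: "?e y \<in> Units B" if y: "y \<in> Units ?K" for y
    proof -
      obtain y' where y': "y' \<in> carrier ?K" "y' \<otimes>\<^bsub>?K\<^esub> y = \<one>\<^bsub>?K\<^esub>" "y \<otimes>\<^bsub>?K\<^esub> y' = \<one>\<^bsub>?K\<^esub>"
        using y unfolding Units_def by blast
      have "y \<in> carrier ?K" using y by (rule K.Units_closed)
      then show ?thesis
        using e_mult[of y y'] e_mult[of y' y] y' e_one e_closed[of y] e_closed[of y']
        unfolding Units_def by auto
    qed
    have cover: "spin_cover B u \<in> hom (GSpin B u) (units_of B)"
    proof (rule homI)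
      fix y z assume "y \<in> carrier (GSpin B u)" "z \<in> carrier (GSpin B u)"
      then have yz: "y \<in> carrier ?K" "z \<in> carrier ?K" by (simp_all add: GSpin_def units_of_def K.Units_closed)
      have "(y \<otimes>\<^bsub>?K\<^esub> z) \<otimes>\<^bsub>?K\<^esub> (y \<otimes>\<^bsub>?K\<^esub> z) = (y \<otimes>\<^bsub>?K\<^esub> y) \<otimes>\<^bsub>?K\<^esub> (z \<otimes>\<^bsub>?K\<^esub> z)"
        using yz by (simp add: K.m_ac)
      then show "spin_cover B u (y \<otimes>\<^bsub>GSpin B u\<^esub> z) = spin_cover B u y \<otimes>\<^bsub>units_of B\<^esub> spin_cover B u z"
        using yz by (simp add: GSpin_def units_of_def spin_cover_def e_mult)
    next
      fix y assume "y \<in> carrier (GSpin B u)"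
      then have "y \<in> Units ?K" by (simp add: GSpin_def units_of_def)
      then have "y \<otimes>\<^bsub>?K\<^esub> y \<in> Units ?K" by simp
      then show "spin_cover B u y \<in> carrier (units_of B)"
        using e_Units by (simp add: spin_cover_def units_of_def)
    qed
    have \<rho>_hom: "\<rho> \<in> hom ?W (units_of B)"
      using \<rho> by (auto simp: hom_def GO_plus_def units_of_def Pi_def)
    have cover_hom: "spin_cover B u \<circ> \<rho>' \<in> hom ?W (units_of B)"
      using \<rho>'(1) cover by (rule Group.hom_compose)
    have "(spin_cover B u \<circ> \<rho>') geom_frob = \<rho> geom_frob"
      using cover_iff[OF x(1)] x(2) \<rho>'(2) \<rho>g by simp
    then have "(spin_cover B u \<circ> \<rho>') w = \<rho> w" if "w \<in> carrier ?W" for w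
      using W.cyclic_hom_eq[OF geom_frob_in_weil_group carrier_weil_group units_group
          cover_hom \<rho>_hom _ that] by blast
    then have "spin_lift B u \<rho> \<rho>'"
      using \<rho>'(1) by (simp add: spin_lift_def)
    then show "\<exists>\<rho>'. spin_lift B u \<rho> \<rho>'" by blast
  qed
qed

theorem theorem5p3p1:
  fixes p q n :: nat
    and E :: "'k::{field,finite} weierstrass"
    and B :: "'b ring"
    and h :: "('k alg_closure point \<Rightarrow> 'k alg_closure point) \<Rightarrow> 'b"
    and \<sigma> :: "'b \<Rightarrow> 'b"
    and u :: 'b
    and \<rho> :: "('k alg_closure \<Rightarrow> 'k alg_closure) \<Rightarrow> 'b"
  assumes "Factorial_Ring.prime p" and "n > 0" and "q = p ^ n" and "CARD('k) = q"
    and "elliptic_curve E"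
    and "is_rational_tensor (End_ring E) B h"
    and "spinorial_type B"
    and "orthogonal_involution B \<sigma>"
    and "disc_unit B \<sigma> u"
    and "similitude_rep E B h \<sigma> \<rho>"
    and "csqrt (of_rat (frobenius_rat E B h)) \<notin> \<rat>"
  shows "(\<exists>\<rho>'. spin_lift B u \<rho> \<rho>')
           \<longleftrightarrow> even_clifford B u \<simeq> rat_adjoin_sqrt (frobenius_rat E B h)"
proof -
  have "CHAR('k) dvd p ^ n"
    using CHAR_dvd_CARD[where ?'a = 'k] assms(3,4) by simp
  moreover have "Factorial_Ring.prime CHAR('k)"
    using prime_CHAR_semidom[where ?'a = 'k] finite_imp_CHAR_pos[where ?'a = 'k] by simp
  ultimately have "CHAR('k) = p"
    using assms(1) prime_dvd_power primes_dvd_imp_eq by blast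
  then have "\<exists>m. CARD('k) = CHAR('k) ^ m" using assms(3,4) by blast
  then interpret prime_power_field "TYPE('k)" by unfold_locales
  obtain a b i j where quat: "quaternion_basis B a b i j"
    using assms(8) quaternion_algebra_basis unfolding orthogonal_involution_def by blast
  interpret quaternion_basis B a b i j by (rule quat)
  have "h (frobenius_endo E) \<in> range (rat_scalar B)"
    using frobenius_central[OF assms(6)] center_eq_rat_scalars by simp
  then obtain t where \<tau>: "h (frobenius_endo E) = rat_scalar B t" by blast
  have t: "frobenius_rat E B h = t"
    unfolding frobenius_rat_def \<tau> by simp
  have irr: "csqrt (of_rat t) \<notin> \<rat>" using assms(11) t by simp
  then have "t \<noteq> 0" by auto
  have unit: "u \<in> Units B" and conj: "quat_conj B u = \<ominus>\<^bsub>B\<^esub> u"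
    using assms(9) by (auto simp: disc_unit_def)
  have nontrivial: "\<one>\<^bsub>B\<^esub> \<noteq> \<zero>\<^bsub>B\<^esub>"
    using rat_scalar_inject[of 1 0] by simp
  have u: "u \<in> carrier B" "u \<noteq> \<zero>\<^bsub>B\<^esub>"
    using unit nontrivial by (auto simp: Units_def)
  have \<rho>: "\<rho> \<in> hom weil_group (GO_plus B \<sigma>)" "\<rho> geom_frob = rat_scalar B t"
    using assms(10) \<tau> by (auto simp: similitude_rep_def)
  have "(\<exists>\<rho>'. spin_lift B u \<rho> \<rho>') \<longleftrightarrow>
    (\<exists>x\<in>carrier (even_clifford B u). x \<otimes>\<^bsub>even_clifford B u\<^esub> x = residue_class (nrd B u) [: t :])"
    using spin_lift_exists_iff[OF quat u conj \<rho> \<open>t \<noteq> 0\<close>] .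
  also have "\<dots> \<longleftrightarrow> even_clifford B u \<simeq> rat_adjoin_sqrt t"
    unfolding even_clifford_quadratic using quadratic_algebra_adjoin_sqrt_iff[OF irr] by blast
  finally show ?thesis unfolding t .
qed

end
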